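(* The root process $\rho(\Phi_Q)$ is a determinantal process on $\mathcal{X}$ with kernel $K_Q$; equivalently, for every $A\subset\mathcal{X}$, $$\mathbb{P}\left(A\subset\rho(\Phi_Q)\right)=\det\nolimits_A(K_Q).$$
   Context: Let $X$ be an irreducible continuous-time Markov process on a finite set $\mathcal{X}$, $|\mathcal{X}|=n$, with generator $(Lf)(x)=\sum_{y\in\mathcal{X}}w(x,y)[f(y)-f(x)]$, where the rates $w(x,y)\in[0,\infty)$ are given (reversibility is not assumed). $P_x$ denotes the law of $X$ started from $x$. Let $\mathcal{E}=\{(x,y)\in\mathcal{X}\times\mathcal{X}: x\neq y,\ w(x,y)>0\}$ and $w(e)=w(x,y)$ for $e=(x,y)\in\mathcal{E}$. A spanning rooted forest is obtained from an undirected simple acyclic graph with vertex set $\mathcal{X}$ by choosing one root in each connected component (tree) and orienting the edges of each tree towards its root; it is identified with its set of oriented edges. $\mathcal{F}$ is the set of spanning rooted forests all of whose oriented edges lie in $\mathcal{E}$ (the empty set is the forest of $n$ isolated roots). For $\phi\in\mathcal{F}$, $\rho(\phi)\subset\mathcal{X}$ is the set of roots and $w(\phi)=\prod_{e\in\phi}w(e)$. Let $q(x)\in[0,\infty]$, $x\in\mathcal{X}$, be killing rates, at least one of which is positive, let $Q$ be the diagonal matrix with entries $q(x)$, and let $S=\{x\in\mathcal{X}:q(x)=+\infty\}$. Set $w_Q(\phi)=w(\phi)\prod_{x\in\rho(\phi)\setminus S}q(x)\,\mathbf{1}_{\{S\subset\rho(\phi)\}}$, $Z_Q=\sum_{\phi\in\mathcal{F}}w_Q(\phi)$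 and $\nu_Q(\phi)=w_Q(\phi)/Z_Q$. $\Phi_Q$ is a random forest with law $\nu_Q$ under $\mathbb{P}$. The process $X$ is stopped (killed) at rate $q(x)$ whenever it is at $x$ (immediately if $q(x)=+\infty$); $T_Q$ is the stopping time and $K_Q(x,y)=P_x(X(T_Q)=y)$ for $x,y\in\mathcal{X}$. For a matrix $M$ indexed by $\mathcal{X}$, $\det_A(M)$ is the determinant of $(M(x,y))_{x,y\in A}$ (equal to 1 if $A=\emptyset$). *)

theory Defs
  imports "HOL-Probability.Probability"
begin

section \<open>Spanning rooted forests\<close>

definition simple_graph :: "'a set set \<Rightarrow> bool" where
  "simple_graph G \<longleftrightarrow> (\<forall>e\<in>G. card e = 2)"

definition simple_path :: "'a set set \<Rightarrow> 'a list \<Rightarrow> bool" where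
  "simple_path G xs \<longleftrightarrow> xs \<noteq> [] \<and> distinct xs \<and> successively (\<lambda>x y. {x, y} \<in> G) xs"

definition acyclic_graph :: "'a set set \<Rightarrow> bool" where
  "acyclic_graph G \<longleftrightarrow> \<not> (\<exists>xs. length xs \<ge> 3 \<and> simple_path G xs \<and> {last xs, hd xs} \<in> G)"

definition same_component :: "'a set set \<Rightarrow> ('a \<times> 'a) set" where
  "same_component G = {(x, y). {x, y} \<in> G}\<^sup>*"

definition one_root_per_component :: "'a set set \<Rightarrow> 'a set \<Rightarrow> bool" where
  "one_root_per_component G R \<longleftrightarrow> (\<forall>x. \<exists>!r. r \<in> R \<and> (x, r) \<in> same_component G)"

text \<open>
  An edge is oriented from \<open>x\<close> to \<open>y\<close> if the path leading from \<open>x\<close> to the root of its tree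
  starts with the step from \<open>x\<close> to \<open>y\<close>.
\<close>

definition orient_to_roots :: "'a set set \<Rightarrow> 'a set \<Rightarrow> ('a \<times> 'a) set" where
  "orient_to_roots G R = {(x, y). \<exists>xs. simple_path G (x # y # xs) \<and> last (y # xs) \<in> R}"

definition spanning_rooted_forest :: "('a \<times> 'a) set \<Rightarrow> bool" where
  "spanning_rooted_forest \<phi> \<longleftrightarrow>
     (\<exists>G R. simple_graph G \<and> acyclic_graph G \<and> one_root_per_component G R
        \<and> \<phi> = orient_to_roots G R)"

text \<open>
  The roots are read off the set of oriented edges. Lemmas \<open>roots_orient_to_roots\<close> and
  \<open>undirect_orient_to_roots\<close> below show that the chosen roots, and the undirected graph, are
  recovered in this way, so that a rooted forest may be identified with its oriented edges.
\<close>

definition roots :: "('a \<times> 'a) set \<Rightarrow> 'a set" where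
  "roots \<phi> = {x. \<forall>y. (x, y) \<notin> \<phi>}"

lemma same_component_last:
  assumes "successively (\<lambda>x y. {x, y} \<in> G) (x # xs)"
  shows "(x, last (x # xs)) \<in> same_component G"
  using assms
proof (induction xs arbitrary: x)
  case Nil
  then show ?case by (simp add: same_component_def)
next
  case (Cons y ys)
  then have "(y, last (y # ys)) \<in> same_component G" and "{x, y} \<in> G" by auto
  then show ?case
    unfolding same_component_def by (auto intro: converse_rtrancl_into_rtrancl)
qed

lemma simple_path_suffix:
  assumes "simple_path G (xs @ y # ys)"
  shows "simple_path G (y # ys)"
  using assms by (auto simp: simple_path_def successively_append_iff)

lemma simple_path_exists:
  assumes "(x, r) \<in> same_component G"
  shows "\<exists>xs. simple_path G (x # xs) \<and> last (x # xs) = r"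
  using assms unfolding same_component_def
proof (induction rule: converse_rtrancl_induct)
  case base
  show ?case by (rule exI[of _ "[]"]) (simp add: simple_path_def)
next
  case (step x y)
  then obtain xs where xs: "simple_path G (y # xs)" "last (y # xs) = r" by blast
  show ?case
  proof (cases "x \<in> set (y # xs)")
    case True
    then obtain us vs where uv: "y # xs = us @ x # vs" by (meson split_list)
    then have "simple_path G (x # vs)" using xs(1) simple_path_suffix[of G us x vs] by simp
    moreover have "last (x # vs) = r" using xs(2) unfolding uv by simp
    ultimately show ?thesis by blast
  next
    case False
    then have "simple_path G (x # y # xs)" using xs step(1) by (auto simp: simple_path_def)
    moreover have "last (x # y # xs) = r" using xs(2) by simp
    ultimately show ?thesis by blast
  qed
qed

lemma roots_orient_to_roots:
  assumes "one_root_per_component G R"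
  shows "roots (orient_to_roots G R) = R"
proof (intro set_eqI iffI)
  fix x assume x: "x \<in> roots (orient_to_roots G R)"
  obtain r where r: "r \<in> R" "(x, r) \<in> same_component G"
    using assms unfolding one_root_per_component_def by blast
  then obtain xs where xs: "simple_path G (x # xs)" "last (x # xs) = r"
    using simple_path_exists by metis
  show "x \<in> R"
  proof (cases xs)
    case Nil
    then show ?thesis using xs r by simp
  next
    case (Cons y ys)
    then have "simple_path G (x # y # ys)" and "last (y # ys) \<in> R" using xs r(1) by simp_all
    then have "(x, y) \<in> orient_to_roots G R" unfolding orient_to_roots_def by blast
    then show ?thesis using x by (simp add: roots_def)
  qed
next
  fix x assume x: "x \<in> R"
  have "(x, y) \<notin> orient_to_roots G R" for y
  proof
    assume "(x, y) \<in> orient_to_roots G R"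
    then obtain xs where xs: "simple_path G (x # y # xs)" "last (y # xs) \<in> R"
      unfolding orient_to_roots_def by blast
    have "(x, last (x # y # xs)) \<in> same_component G"
      using xs(1) by (intro same_component_last) (auto simp: simple_path_def)
    then have "(x, last (y # xs)) \<in> same_component G" by simp
    moreover have "(x, x) \<in> same_component G" by (simp add: same_component_def)
    ultimately have "last (y # xs) = x"
      using assms x xs(2) unfolding one_root_per_component_def by blast
    then show False using xs(1) last_in_set[of "y # xs"] by (simp add: simple_path_def)
  qed
  then show "x \<in> roots (orient_to_roots G R)" by (simp add: roots_def)
qed

lemma undirect_orient_to_roots:
  assumes "simple_graph G" and "one_root_per_component G R"
  shows "(\<lambda>(x, y). {x, y}) ` orient_to_roots G R = G"
proof (intro set_eqI iffI)
  fix e assume "e \<in> (\<lambda>(x, y). {x, y}) ` orient_to_roots G R"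
  then show "e \<in> G" by (auto simp: orient_to_roots_def simple_path_def)
next
  fix e assume e: "e \<in> G"
  then have "card e = 2" using assms(1) by (auto simp: simple_graph_def)
  then obtain x y where xy: "e = {x, y}" "x \<noteq> y" by (auto simp: card_2_iff)
  obtain r where r: "r \<in> R" "(x, r) \<in> same_component G"
    using assms(2) unfolding one_root_per_component_def by blast
  then obtain xs where xs: "simple_path G (x # xs)" "last (x # xs) = r"
    using simple_path_exists by metis
  have "(x, y) \<in> orient_to_roots G R \<or> (y, x) \<in> orient_to_roots G R"
  proof (cases "y \<in> set xs")
    case True
    then obtain us vs where uv: "xs = us @ y # vs" by (meson split_list)
    then have "simple_path G (y # vs)" using xs(1) simple_path_suffix[of G "x # us" y vs] by simp
    moreover have "x \<notin> set (y # vs)" using xs(1) uv by (auto simp: simple_path_def)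
    ultimately have "simple_path G (x # y # vs)" using e xy by (auto simp: simple_path_def)
    moreover have "last (y # vs) \<in> R" using xs(2) uv r by auto
    ultimately show ?thesis unfolding orient_to_roots_def by blast
  next
    case False
    then have "simple_path G (y # x # xs)"
      using e xy xs(1) by (auto simp: simple_path_def insert_commute[of y x])
    then show ?thesis using xs(2) r unfolding orient_to_roots_def by blast
  qed
  then show "e \<in> (\<lambda>(x, y). {x, y}) ` orient_to_roots G R"
  proof
    assume "(x, y) \<in> orient_to_roots G R"
    then show ?thesis using xy by (intro image_eqI[of _ _ "(x, y)"]) simp_all
  next
    assume "(y, x) \<in> orient_to_roots G R"
    then show ?thesis using xy by (intro image_eqI[of _ _ "(y, x)"]) auto
  qed
qed

section \<open>Weighted forests and the forest measure\<close>

definition rate_edges :: "('a \<Rightarrow> 'a \<Rightarrow> real) \<Rightarrow> ('a \<times> 'a) set" where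
  "rate_edges w = {(x, y). x \<noteq> y \<and> w x y > 0}"

definition irreducible_rates :: "('a \<Rightarrow> 'a \<Rightarrow> real) \<Rightarrow> bool" where
  "irreducible_rates w \<longleftrightarrow> (\<forall>x y. (x, y) \<in> (rate_edges w)\<^sup>*)"

definition forests :: "('a \<Rightarrow> 'a \<Rightarrow> real) \<Rightarrow> ('a \<times> 'a) set set" where
  "forests w = {\<phi>. spanning_rooted_forest \<phi> \<and> \<phi> \<subseteq> rate_edges w}"

definition forest_weight :: "('a \<Rightarrow> 'a \<Rightarrow> real) \<Rightarrow> ('a \<times> 'a) set \<Rightarrow> real" where
  "forest_weight w \<phi> = (\<Prod>(x, y)\<in>\<phi>. w x y)"

definition infinite_killing :: "('a \<Rightarrow> ennreal) \<Rightarrow> 'a set" where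
  "infinite_killing q = {x. q x = \<infinity>}"

definition killed_forest_weight ::
  "('a \<Rightarrow> 'a \<Rightarrow> real) \<Rightarrow> ('a \<Rightarrow> ennreal) \<Rightarrow> ('a \<times> 'a) set \<Rightarrow> real" where
  "killed_forest_weight w q \<phi> =
     forest_weight w \<phi> * (\<Prod>x\<in>roots \<phi> - infinite_killing q. enn2real (q x))
       * (if infinite_killing q \<subseteq> roots \<phi> then 1 else 0)"

definition forest_partition_function ::
  "('a \<Rightarrow> 'a \<Rightarrow> real) \<Rightarrow> ('a \<Rightarrow> ennreal) \<Rightarrow> real" where
  "forest_partition_function w q = (\<Sum>\<phi>\<in>forests w. killed_forest_weight w q \<phi>)"

definition forest_law ::
  "('a \<Rightarrow> 'a \<Rightarrow> real) \<Rightarrow> ('a \<Rightarrow> ennreal) \<Rightarrow> ('a \<times> 'a) set \<Rightarrow> real" where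
  "forest_law w q \<phi> = killed_forest_weight w q \<phi> / forest_partition_function w q"

section \<open>The Markov process and its killing\<close>

definition generator ::
  "('a::finite \<Rightarrow> 'a \<Rightarrow> real) \<Rightarrow> ('a \<Rightarrow> real) \<Rightarrow> 'a \<Rightarrow> real" where
  "generator w f x = (\<Sum>y\<in>UNIV. w x y * (f y - f x))"

definition past_events :: "'w measure \<Rightarrow> (real \<Rightarrow> 'w \<Rightarrow> 'a) \<Rightarrow> real \<Rightarrow> 'w set set" where
  "past_events M X t =
     sigma_sets (space M) {X r -` {y} \<inter> space M | r y. 0 \<le> r \<and> r \<le> t}"

text \<open>
  The state space carries the discrete topology: a path is right-continuous iff it is eventually
  constant to the right of each time, and it has a left limit iff it is eventually constant to
  the left. The process is indexed by \<open>real\<close>, but only times \<open>t \<ge> 0\<close> are constrained.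
\<close>

locale markov_process =
  fixes w :: "'a::finite \<Rightarrow> 'a \<Rightarrow> real"
    and M :: "'w measure"
    and P :: "'a \<Rightarrow> 'w measure"
    and X :: "real \<Rightarrow> 'w \<Rightarrow> 'a"
  assumes prob_space_P: "prob_space (P x)"
    and sets_P: "sets (P x) = sets M"
    and measurable_X: "0 \<le> t \<Longrightarrow> X t \<in> measurable M (count_space UNIV)"
    and right_continuous:
      "\<omega> \<in> space M \<Longrightarrow> 0 \<le> t \<Longrightarrow> eventually (\<lambda>s. X s \<omega> = X t \<omega>) (at_right t)"
    and left_limits:
      "\<omega> \<in> space M \<Longrightarrow> 0 < t \<Longrightarrow> \<exists>y. eventually (\<lambda>s. X s \<omega> = y) (at_left t)"
    and initial_state: "measure (P x) {\<omega> \<in> space M. X 0 \<omega> = x} = 1"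
    and markov_property:
      "0 \<le> t \<Longrightarrow> 0 \<le> s \<Longrightarrow> B \<in> past_events M X t \<Longrightarrow>
         measure (P x) {\<omega> \<in> B. X t \<omega> = y \<and> X (t + s) \<omega> = z} =
         measure (P x) {\<omega> \<in> B. X t \<omega> = y} * measure (P y) {\<omega> \<in> space M. X s \<omega> = z}"
    and has_generator:
      "((\<lambda>t. ((\<integral>\<omega>. f (X t \<omega>) \<partial>P x) - f x) / t) \<longlongrightarrow> generator w f x) (at_right 0)"

text \<open>
  Killing at rate \<open>q\<close>: with a clock \<open>u\<close> that is exponentially distributed with parameter 1 and
  independent of the process, the process is stopped when its accumulated killing rate reaches
  \<open>u\<close>, or as soon as it visits a point with infinite rate. The infimum of the empty set is
  \<open>\<infinity>\<close>: such a path is never stopped and does not contribute to the kernel.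
\<close>

definition killing_time ::
  "(real \<Rightarrow> 'w \<Rightarrow> 'a) \<Rightarrow> ('a \<Rightarrow> ennreal) \<Rightarrow> 'w \<Rightarrow> real \<Rightarrow> ereal" where
  "killing_time X q \<omega> u =
     Inf (ereal ` {t. 0 \<le> t \<and> (X t \<omega> \<in> infinite_killing q \<or>
                     ennreal u \<le> (\<integral>\<^sup>+ s\<in>{0..t}. q (X s \<omega>) \<partial>lborel))})"

definition exponential_clock :: "real measure" where
  "exponential_clock = density lborel (\<lambda>u. ennreal (exponential_density 1 u))"

definition killing_kernel ::
  "('a \<Rightarrow> 'w measure) \<Rightarrow> (real \<Rightarrow> 'w \<Rightarrow> 'a) \<Rightarrow> ('a \<Rightarrow> ennreal) \<Rightarrow> 'a \<Rightarrow> 'a \<Rightarrow> real" where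
  "killing_kernel P X q x y =
     measure (P x \<Otimes>\<^sub>M exponential_clock)
       {(\<omega>, u) \<in> space (P x \<Otimes>\<^sub>M exponential_clock).
          killing_time X q \<omega> u < \<infinity> \<and> X (real_of_ereal (killing_time X q \<omega> u)) \<omega> = y}"

section \<open>Determinants over a set of indices\<close>

definition det_on :: "'a set \<Rightarrow> ('a \<Rightarrow> 'a \<Rightarrow> real) \<Rightarrow> real" where
  "det_on A K = (\<Sum>p | p permutes A. of_int (sign p) * (\<Prod>x\<in>A. K x (p x)))"

lemma det_on_UNIV: "det_on UNIV K = det (\<chi> x y. K x y)"
  by (simp add: det_on_def det_def)

end

theory Submission
  imports Defs
begin

text \<open>
  A spanning rooted forest is the same as a map \<open>f\<close> whose iterates lead every point to a fixed point,
  the fixed points being the roots. Expanding the determinant of \<open>Q - L\<close> (with unit rows on the points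
  of infinite rate) row by row gives a sum over all maps, in which exactly the forests survive. As the
  killing kernel \<open>K\<close> solves \<open>(Q - L) K = Q\<close>, multiplying by \<open>K\<close> with unit columns outside \<open>A\<close> turns
  \<open>det\<^sub>A K\<close> into the quotient of two such forest sums.

  The linear system for \<open>K\<close> is obtained without the strong Markov property: observing the process and its
  accumulated killing rate only at multiples of \<open>h\<close> gives a killed Markov chain, whose kernel \<open>K\<^sub>h\<close>
  solves \<open>K\<^sub>h = (1 - e\<^sub>h) + e\<^sub>h P\<^sub>h K\<^sub>h\<close> with \<open>e\<^sub>h = exp (- h q)\<close>. For almost every path and clock the
  two killing positions agree for small \<open>h\<close>, so \<open>K\<^sub>h\<close> tends to \<open>K\<close>, and dividing by \<open>h\<close> yields the system.
\<close>

section \<open>Rooted forests as maps\<close>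

text \<open>Two obstacles shape the passage from the grid to the process: the position at the
  killing time may depend discontinuously on the grid, and a grid limit may lose mass. The first is
  met through levels: unless the clock value is one of countably many accumulated rates at jump
  times, it is crossed strictly inside an interval on which the path is constant, so the killing
  time has to be located only up to that interval. The second needs almost sure killing, which comes
  from the same matrix: \<open>Q - L\<close> is nonsingular by a maximum principle under
  irreducibility, so \<open>(Q - L) v = 1\<close> has a solution, and a telescoping argument with
  \<open>v\<close> bounds the probability of surviving the grid up to time \<open>t\<close> by a
  constant over \<open>t\<close>, uniformly in fine grids. Deterministic grid times fit the
  hypotheses, which give the Markov property at fixed times and the generator as a derivative at
  time \<open>0\<close>. Points of infinite rate are built in throughout: survival factor
  \<open>0\<close> in the chain matches a unit row of the matrix and, in the forest sum, root weight
  \<open>1\<close> with no outgoing weight.\<close>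

definition rooted_map :: "('a \<Rightarrow> 'a) \<Rightarrow> bool" where
  "rooted_map f \<longleftrightarrow> (\<forall>x. \<exists>n. f ((f ^^ n) x) = (f ^^ n) x)"

definition map_edges :: "('a \<Rightarrow> 'a) \<Rightarrow> ('a \<times> 'a) set" where
  "map_edges f = {(x, f x) | x. f x \<noteq> x}"

lemma mem_map_edges [simp]: "(x, y) \<in> map_edges f \<longleftrightarrow> y = f x \<and> f x \<noteq> x"
  by (auto simp: map_edges_def)

lemma inj_map_edges: "inj map_edges"
proof (rule injI, rule ext)
  fix f g :: "'a \<Rightarrow> 'a" and x assume eq: "map_edges f = map_edges g"
  have "(x, y) \<in> map_edges f \<longleftrightarrow> (x, y) \<in> map_edges g" for y using eq by simp
  from this[of "f x"] this[of "g x"] show "f x = g x" by auto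
qed

lemma roots_map_edges: "roots (map_edges f) = {x. f x = x}"
  by (auto simp: roots_def)

lemma funpow_fixed_mono:
  assumes "f ((f ^^ n) x) = (f ^^ n) x" and "n \<le> m"
  shows "(f ^^ m) x = (f ^^ n) x"
  using assms(2) by (induction rule: dec_induct) (use assms(1) in auto)

lemma rooted_map_bound:
  fixes f :: "'a::finite \<Rightarrow> 'a"
  assumes "rooted_map f"
  shows "\<exists>N. \<forall>x. f ((f ^^ N) x) = (f ^^ N) x"
proof -
  obtain d where d: "f ((f ^^ d x) x) = (f ^^ d x) x" for x
    using assms unfolding rooted_map_def by metis
  have "f ((f ^^ Max (range d)) x) = (f ^^ Max (range d)) x" for x
    using funpow_fixed_mono[OF d[of x], of "Max (range d)"] d[of x] by simp
  then show ?thesis by blast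
qed

text \<open>The distance to the fixed point serves as a potential that drops by one along every
  edge; it rules out cycles below.\<close>

lemma rooted_map_depth:
  assumes "rooted_map f"
  shows "\<exists>d :: 'a \<Rightarrow> nat. \<forall>x. f x \<noteq> x \<longrightarrow> d x = Suc (d (f x))"
proof (intro exI allI impI)
  fix x assume x: "f x \<noteq> x"
  define P where "P x n \<longleftrightarrow> f ((f ^^ n) x) = (f ^^ n) x" for x n
  have ex: "\<exists>n. P x n" using assms unfolding rooted_map_def P_def by blast
  have Suc: "P x (Suc n) \<longleftrightarrow> P (f x) n" for n by (simp add: P_def funpow_swap1)
  have "\<not> P x 0" using x by (simp add: P_def)
  then have "(LEAST n. P x n) = Suc (LEAST n. P x (Suc n))"
    using ex by (metis Least_Suc)
  \<comment> \<open>This fixes the witness: the depth of \<open>x\<close> is the least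
    \<open>n\<close> with \<open>P x n\<close>.\<close>
  then show "(LEAST n. P x n) = Suc (LEAST n. P (f x) n)" by (simp only: Suc)
qed

section \<open>The undirected graph of a rooted map\<close>

definition undirected_map_graph :: "('a \<Rightarrow> 'a) \<Rightarrow> 'a set set" where
  "undirected_map_graph f = {{x, f x} | x. f x \<noteq> x}"

lemma mem_undirected_map_graph [simp]:
  "{x, y} \<in> undirected_map_graph f \<longleftrightarrow> x \<noteq> y \<and> (y = f x \<or> x = f y)"
  unfolding undirected_map_graph_def by (auto simp: doubleton_eq_iff)

text \<open>At a deepest vertex \<open>x\<close> of a cycle no neighbour \<open>y\<close> can
  satisfy \<open>f y = x\<close>, since \<open>y\<close> would be deeper. Both cycle neighbours of
  \<open>x\<close> are then \<open>f x\<close>, although a cycle of length at least 3 makes them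
  distinct.\<close>

lemma acyclic_undirected_map_graph:
  assumes "rooted_map f"
  shows "acyclic_graph (undirected_map_graph f)"
  unfolding acyclic_graph_def
proof
  let ?G = "undirected_map_graph f"
  assume "\<exists>xs. length xs \<ge> 3 \<and> simple_path ?G xs \<and> {last xs, hd xs} \<in> ?G"
  then obtain xs where xs: "length xs \<ge> 3" "simple_path ?G xs" "{last xs, hd xs} \<in> ?G" by blast
  obtain d :: "'a \<Rightarrow> nat" where d: "\<And>x. f x \<noteq> x \<Longrightarrow> d x = Suc (d (f x))"
    using rooted_map_depth[OF assms] by blast
  have "xs \<noteq> []" using xs(1) by auto
  then have "Max (d ` set xs) \<in> d ` set xs" by (intro Max_in) auto
  then obtain x where x: "x \<in> set xs" and dx: "Max (d ` set xs) = d x" by auto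
  have mx: "d y \<le> d x" if "y \<in> set xs" for y
    unfolding dx[symmetric] by (rule Max_ge) (use that in auto)
  obtain us vs where uv: "xs = us @ x # vs" using x by (meson split_list)
  \<comment> \<open>The cycle is rotated to start at \<open>x\<close>, whose two neighbours are then
    \<open>hd ys\<close> and \<open>last ys\<close>.\<close>
  define ys where "ys = vs @ us"
  have len: "length ys \<ge> 2" using xs(1) uv by (simp add: ys_def)
  have ne: "ys \<noteq> []" using len by auto
  have dist: "distinct (x # ys)" using xs(2) uv by (auto simp: simple_path_def ys_def)
  have sub: "set ys \<subseteq> set xs" using uv by (auto simp: ys_def)
  have suc: "successively (\<lambda>x y. {x, y} \<in> ?G) xs" using xs(2) by (simp add: simple_path_def)
  have hd: "{x, hd ys} \<in> ?G"
    using suc xs(3) ne unfolding uv ys_def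
    by (cases vs) (auto simp: successively_append_iff successively_Cons simp del: mem_undirected_map_graph)
  have last: "{last ys, x} \<in> ?G"
    using suc xs(3) ne unfolding uv ys_def
    by (cases us) (auto simp: successively_append_iff successively_Cons simp del: mem_undirected_map_graph)
  have "y = f x" if y: "y \<in> set ys" "{x, y} \<in> ?G" for y
  proof (rule ccontr)
    assume "y \<noteq> f x"
    then have "x = f y" "f y \<noteq> y" using y(2) by auto
    then have "d y = Suc (d x)" using d by metis
    then show False using mx[of y] y(1) sub by auto
  qed
  then have "hd ys = last ys" using hd last ne by (metis hd_in_set insert_commute last_in_set)
  moreover have "hd ys \<noteq> last ys" using len dist
    by (cases ys) (auto split: if_splits)
  ultimately show False by simp
qed

text \<open>For an \<open>N\<close> that is large enough for all points, \<open>f ^^ N\<close>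
  agrees at both ends of each edge. It is therefore constant on components, and its value is the
  only fixed point there.\<close>

lemma one_root_undirected_map_graph:
  fixes f :: "'a::finite \<Rightarrow> 'a"
  assumes "rooted_map f"
  shows "one_root_per_component (undirected_map_graph f) {x. f x = x}"
  unfolding one_root_per_component_def
proof
  fix x
  let ?G = "undirected_map_graph f"
  obtain N where N: "\<And>x. f ((f ^^ N) x) = (f ^^ N) x" using rooted_map_bound[OF assms] by blast
  have step: "(y, f y) \<in> same_component ?G" for y
    by (cases "f y = y") (auto simp: same_component_def intro!: r_into_rtrancl)
  have reach: "(y, (f ^^ n) y) \<in> same_component ?G" for y n
  proof (induction n)
    case (Suc n)
    then show ?case using step[of "(f ^^ n) y"]
      unfolding same_component_def by (auto intro: rtrancl_trans)
  qed (simp add: same_component_def)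
  have "(f ^^ N) (f y) = (f ^^ N) y" for y using N[of y] by (simp add: funpow_swap1)
  then have edge: "(f ^^ N) y = (f ^^ N) z" if "{y, z} \<in> ?G" for y z
    using that by (metis mem_undirected_map_graph)
  have inv: "(f ^^ N) y = (f ^^ N) z" if "(y, z) \<in> same_component ?G" for y z
    using that unfolding same_component_def
    by (induction rule: rtrancl_induct) (use edge in auto)
  have fixed: "(f ^^ N) r = r" if "f r = r" for r
    using that by (induction N) auto
  show "\<exists>!r. r \<in> {x. f x = x} \<and> (x, r) \<in> same_component ?G"
  proof (rule ex1I[of _ "(f ^^ N) x"])
    show "(f ^^ N) x \<in> {x. f x = x} \<and> (x, (f ^^ N) x) \<in> same_component ?G"
      using N reach by simp
  next
    fix r assume "r \<in> {x. f x = x} \<and> (x, r) \<in> same_component ?G"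
    then show "r = (f ^^ N) x" using inv[of x r] fixed[of r] by simp
  qed
qed

text \<open>On a simple path ending at a fixed point every step follows \<open>f\<close>: by
  induction from the end the second step does, and an initial step against \<open>f\<close> would
  make the first and third vertices coincide.\<close>

lemma orient_undirected_map_graph:
  fixes f :: "'a::finite \<Rightarrow> 'a"
  assumes "rooted_map f"
  shows "orient_to_roots (undirected_map_graph f) {x. f x = x} = map_edges f"
proof -
  let ?G = "undirected_map_graph f"
  have *: "y = f x" if "simple_path ?G (x # y # xs)" "f (last (y # xs)) = last (y # xs)" for x y xs
    using that
  proof (induction xs arbitrary: x y)
    case Nil
    then have "x \<noteq> y" "y = f x \<or> x = f y" by (auto simp: simple_path_def simp del: last.simps)
    moreover have "f y = y" using Nil(2) by simp
    ultimately show ?case by metis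
  next
    case (Cons z zs)
    have "simple_path ?G (y # z # zs)" using Cons.prems(1) by (auto simp: simple_path_def)
    moreover have "last (y # z # zs) = last (z # zs)" by simp
    ultimately have "z = f y" using Cons.IH Cons.prems(2) by metis
    moreover have "x \<noteq> z" "y = f x \<or> x = f y" using Cons.prems(1) by (simp_all add: simple_path_def)
    ultimately show ?case by blast
  qed
  have "(x, y) \<in> map_edges f" if xy: "(x, y) \<in> orient_to_roots ?G {x. f x = x}" for x y
  proof -
    obtain xs where xs: "simple_path ?G (x # y # xs)" "f (last (y # xs)) = last (y # xs)"
      using xy unfolding orient_to_roots_def by blast
    then have "y = f x" using * by blast
    moreover have "x \<noteq> y" using xs(1) by (auto simp: simple_path_def)
    ultimately show ?thesis by auto
  qed
  moreover have "(x, f x) \<in> orient_to_roots ?G {x. f x = x}" if "f x \<noteq> x" for x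
  proof -
    \<comment> \<open>The path out of \<open>x\<close> is not built by hand: \<open>x\<close> is no
      root, so some oriented edge leaves it, and by the first claim that edge leads to
      \<open>f x\<close>.\<close>
    have "x \<notin> roots (orient_to_roots ?G {x. f x = x})"
      using that roots_orient_to_roots[OF one_root_undirected_map_graph[OF assms]] by simp
    then obtain y where y: "(x, y) \<in> orient_to_roots ?G {x. f x = x}"
      by (auto simp: roots_def)
    then obtain xs where xs: "simple_path ?G (x # y # xs)" "f (last (y # xs)) = last (y # xs)"
      unfolding orient_to_roots_def by blast
    then have "y = f x" using * by blast
    then show ?thesis using y by simp
  qed
  ultimately have "(x, y) \<in> orient_to_roots ?G {x. f x = x} \<longleftrightarrow> (x, y) \<in> map_edges f" for x y
    by (metis mem_map_edges)
  then show ?thesis by (intro set_eqI) (simp only: split_paired_all)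
qed

lemma spanning_rooted_forest_map_edges:
  fixes f :: "'a::finite \<Rightarrow> 'a"
  assumes "rooted_map f"
  shows "spanning_rooted_forest (map_edges f)"
proof -
  have "simple_graph (undirected_map_graph f)"
    by (auto simp: simple_graph_def undirected_map_graph_def)
  then show ?thesis
    unfolding spanning_rooted_forest_def
    by (intro exI[of _ "undirected_map_graph f"] exI[of _ "{x. f x = x}"] conjI
        acyclic_undirected_map_graph one_root_undirected_map_graph
        orient_undirected_map_graph[symmetric] assms)
qed

text \<open>Two paths that leave \<open>x\<close> through different neighbours and end at the same vertex close up to
  a cycle at the first vertex of one that lies on the other.\<close>

lemma acyclic_graph_path_unique:
  assumes G: "acyclic_graph G"
    and p: "simple_path G (x # y # xs)" and p': "simple_path G (x # y' # xs')"
    and l: "last (y # xs) = last (y' # xs')"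
  shows "y = y'"
proof (rule ccontr)
  assume ne: "y \<noteq> y'"
  have "\<exists>v\<in>set (y # xs). v \<in> set (y' # xs')"
    using l by (metis last_in_set list.distinct(1))
  then obtain us v vs where uv: "y # xs = us @ v # vs" "v \<in> set (y' # xs')"
    "\<forall>u\<in>set us. u \<notin> set (y' # xs')"
    using split_list_first_prop[of "y # xs" "\<lambda>v. v \<in> set (y' # xs')"] by blast
  obtain us' vs' where uv': "y' # xs' = us' @ v # vs'"
    using uv(2) by (meson split_list)
  define c where "c = x # us @ v # rev us'"
  have s: "successively (\<lambda>x y. {x, y} \<in> G) (x # us @ v # vs)"
    "distinct (x # us @ v # vs)"
    using p uv(1) by (auto simp: simple_path_def)
  have s': "successively (\<lambda>x y. {x, y} \<in> G) (x # us' @ v # vs')"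
    "distinct (x # us' @ v # vs')"
    using p' uv'(1) by (auto simp: simple_path_def)
  have "set us \<inter> set us' = {}" using uv(3) uv' by auto
  then have "distinct c" using s(2) s'(2) by (auto simp: c_def)
  moreover have "successively (\<lambda>x y. {x, y} \<in> G) c"
  proof -
    have "successively (\<lambda>x y. {x, y} \<in> G) ((x # us) @ [v])"
      using s(1) successively_append_iff[of _ "(x # us) @ [v]" vs] by simp
    moreover have "successively (\<lambda>x y. {x, y} \<in> G) (us' @ [v])"
      using s'(1) by (auto simp add: successively_append_iff successively_Cons)
    then have "successively (\<lambda>x y. {x, y} \<in> G) (rev (us' @ [v]))"
      by (subst successively_rev) (simp add: insert_commute)
    then have "successively (\<lambda>x y. {x, y} \<in> G) (v # rev us')" by simp
    ultimately show ?thesis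
      unfolding c_def using successively_append_iff[of _ "x # us" "[v]"]
        successively_append_iff[of _ "x # us" "v # rev us'"] by simp
  qed
  \<comment> \<open>Here \<open>y \<noteq> y'\<close> enters: if \<open>us\<close> is empty, the
    meeting point is \<open>y\<close> itself, so \<open>us'\<close> begins with
    \<open>y'\<close>.\<close>
  moreover have "length c \<ge> 3"
  proof (cases us)
    case Nil
    then have "us' \<noteq> []" using uv(1) uv' ne by auto
    then show ?thesis by (cases us') (auto simp: c_def)
  qed (auto simp: c_def)
  moreover have "{last c, hd c} \<in> G"
    using s'(1) by (cases us')
      (auto simp: c_def successively_append_iff successively_Cons insert_commute split: if_splits)
  ultimately show False using G unfolding acyclic_graph_def simple_path_def c_def by blast
qed

text \<open>Every edge out of \<open>x\<close> begins a simple path to the root of the component of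
  \<open>x\<close>. That root is unique, so by uniqueness of paths \<open>\<phi>\<close> is the
  graph of a partial function, which \<open>f\<close> extends by fixing the roots.\<close>

lemma spanning_rooted_forest_imp_map:
  assumes "spanning_rooted_forest \<phi>"
  shows "\<exists>f. rooted_map f \<and> \<phi> = map_edges f"
proof -
  obtain G R where G: "simple_graph G" "acyclic_graph G" and R: "one_root_per_component G R"
    and \<phi>: "\<phi> = orient_to_roots G R"
    using assms unfolding spanning_rooted_forest_def by blast
  have unique: "y = y'" if e: "(x, y) \<in> \<phi>" "(x, y') \<in> \<phi>" for x y y'
  proof -
    obtain xs where xs: "simple_path G (x # y # xs)" "last (y # xs) \<in> R"
      using e(1) unfolding \<phi> orient_to_roots_def by blast
    obtain xs' where xs': "simple_path G (x # y' # xs')" "last (y' # xs') \<in> R"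
      using e(2) unfolding \<phi> orient_to_roots_def by blast
    have "(x, last (x # y # xs)) \<in> same_component G" "(x, last (x # y' # xs')) \<in> same_component G"
      using xs(1) xs'(1) by (intro same_component_last; simp add: simple_path_def)+
    then have "last (y # xs) = last (y' # xs')"
      using xs(2) xs'(2) R unfolding one_root_per_component_def
      by (metis last.simps list.distinct(1))
    then show ?thesis using acyclic_graph_path_unique[OF G(2) xs(1) xs'(1)] by simp
  qed
  have roots: "roots \<phi> = R" unfolding \<phi> by (rule roots_orient_to_roots[OF R])
  define f where "f x = (if x \<in> R then x else (SOME y. (x, y) \<in> \<phi>))" for x
  have f: "(x, f x) \<in> \<phi>" if "x \<notin> R" for x
  proof -
    have "\<exists>y. (x, y) \<in> \<phi>" using that roots by (auto simp: roots_def)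
    then have "(x, SOME y. (x, y) \<in> \<phi>) \<in> \<phi>" by (rule someI_ex)
    then show ?thesis using that by (simp add: f_def)
  qed
  have irrefl: "x \<noteq> y" if "(x, y) \<in> \<phi>" for x y
    using that by (auto simp: \<phi> orient_to_roots_def simple_path_def)
  have notR: "x \<notin> R" if "(x, y) \<in> \<phi>" for x y using that roots by (auto simp: roots_def)
  have f_iff: "(x, y) \<in> \<phi> \<longleftrightarrow> y = f x \<and> f x \<noteq> x" for x y
  proof
    assume "(x, y) \<in> \<phi>"
    then show "y = f x \<and> f x \<noteq> x" using notR f irrefl unique by metis
  next
    assume "y = f x \<and> f x \<noteq> x"
    then show "(x, y) \<in> \<phi>" using f by (metis f_def)
  qed
  have path: "\<exists>n. (f ^^ n) x \<in> R" if "simple_path G (x # xs)" "last (x # xs) \<in> R" for x xs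
    using that
  proof (induction xs arbitrary: x)
    case Nil
    then show ?case by (auto intro: exI[of _ 0])
  next
    case (Cons y ys)
    then have "simple_path G (x # y # ys) \<and> last (y # ys) \<in> R" by simp
    then have "(x, y) \<in> \<phi>" unfolding \<phi> orient_to_roots_def by blast
    then have "y = f x" using f_iff by blast
    moreover have "\<exists>n. (f ^^ n) y \<in> R"
      using Cons by (auto simp: simple_path_def)
    ultimately obtain n where "(f ^^ n) (f x) \<in> R" by blast
    then show ?case by (intro exI[of _ "Suc n"]) (simp add: funpow_swap1)
  qed
  have "\<exists>n. f ((f ^^ n) x) = (f ^^ n) x" for x
  proof -
    obtain r where r: "r \<in> R" "(x, r) \<in> same_component G"
      using R unfolding one_root_per_component_def by blast
    obtain xs where "simple_path G (x # xs)" "last (x # xs) = r"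
      using simple_path_exists[OF r(2)] by blast
    then obtain n where "(f ^^ n) x \<in> R" using path[of x xs] r(1) by auto
    then show ?thesis by (auto simp: f_def)
  qed
  then have "rooted_map f" by (simp add: rooted_map_def)
  moreover have "\<phi> = map_edges f" using f_iff by auto
  ultimately show ?thesis by blast
qed

section \<open>The matrix-forest theorem\<close>

text \<open>The diagonal entry \<open>c x x\<close> plays the role of the weight of \<open>x\<close> as a root.\<close>

definition forest_matrix :: "('a::finite \<Rightarrow> 'a \<Rightarrow> real) \<Rightarrow> real ^ 'a ^ 'a" where
  "forest_matrix c = (\<chi> x y. if x = y then (\<Sum>z\<in>UNIV. c x z) else - c x y)"

text \<open>Identifies the matrix as \<open>Q - L\<close> with \<open>Q\<close> the diagonal of
  \<open>c\<close>: that diagonal drops out of \<open>generator c\<close>, where it multiplies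
  \<open>f x - f x\<close>.\<close>

lemma forest_matrix_mult:
  "(\<Sum>z\<in>UNIV. forest_matrix c $ x $ z * f z) = c x x * f x - generator c f x"
proof -
  have "(\<Sum>z\<in>UNIV. forest_matrix c $ x $ z * f z) =
    (\<Sum>z\<in>UNIV. c x z) * f x - (\<Sum>z\<in>UNIV - {x}. c x z * f z)"
    by (simp add: forest_matrix_def sum.remove[of UNIV x] sum_negf)
  also have "\<dots> = c x x * f x - generator c f x"
    by (simp add: generator_def sum.remove[of UNIV x] sum_subtractf sum_distrib_left
        sum_distrib_right algebra_simps)
  finally show ?thesis .
qed

text \<open>Row \<open>x\<close> is the vector left in row \<open>x\<close> of
  \<open>forest_matrix c\<close> after choosing the summand with weight \<open>c x (f x)\<close>. At
  a fixed point it is \<open>axis x 1\<close>, not the zero vector that the other branch would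
  give.\<close>

definition map_matrix :: "('a::finite \<Rightarrow> 'a) \<Rightarrow> real ^ 'a ^ 'a" where
  "map_matrix f = (\<chi> x. if f x = x then axis x 1 else axis x 1 - axis (f x) 1)"

lemma map_matrix_nth:
  "map_matrix f $ x $ y = (if x = y then 1 else if y = f x then - 1 else 0)"
  by (auto simp: map_matrix_def axis_def)

text \<open>In the Leibniz sum a contributing permutation agrees with \<open>f\<close> at every
  point it moves. By injectivity it keeps moving along the orbit of such a point, so this orbit
  under \<open>f\<close> would never reach a fixed point. Only \<open>id\<close> remains.\<close>

lemma det_map_matrix_rooted:
  assumes "rooted_map f"
  shows "det (map_matrix f) = 1"
proof -
  have zero: "(\<Prod>x\<in>UNIV. map_matrix f $ x $ p x) = 0" if p: "p permutes UNIV" "p \<noteq> id" for p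
  proof (rule ccontr)
    assume "(\<Prod>x\<in>UNIV. map_matrix f $ x $ p x) \<noteq> 0"
    then have nz: "map_matrix f $ x $ p x \<noteq> 0" for x by simp
    have f: "p x = f x" if "p x \<noteq> x" for x
      using nz[of x] that by (auto simp: map_matrix_nth split: if_splits)
    have inj: "inj p" using p(1) by (simp add: permutes_inj)
    obtain x where x: "p x \<noteq> x" using p(2) by (auto simp: fun_eq_iff)
    have "p ((f ^^ n) x) \<noteq> (f ^^ n) x" for n
    proof (induction n)
      case (Suc n)
      then have "f ((f ^^ n) x) = p ((f ^^ n) x)" using f by simp
      then show ?case using Suc inj by (auto simp: inj_eq)
    qed (use x in simp)
    then have "f ((f ^^ n) x) \<noteq> (f ^^ n) x" for n using f by metis
    then show False using assms unfolding rooted_map_def by blast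
  qed
  have "det (map_matrix f) =
    (\<Sum>p\<in>{id}. of_int (sign p) * (\<Prod>x\<in>UNIV. map_matrix f $ x $ p x))"
    unfolding det_def
    by (rule sum.mono_neutral_right) (auto simp: permutes_id zero)
  then show ?thesis by (simp add: map_matrix_nth)
qed

text \<open>The indicator of the points that are never absorbed spans part of the kernel.\<close>

lemma det_map_matrix_not_rooted:
  assumes "\<not> rooted_map f"
  shows "det (map_matrix f) = 0"
proof (rule ccontr)
  assume "det (map_matrix f) \<noteq> 0"
  then have ker: "map_matrix f *v v = 0 \<Longrightarrow> v = 0" for v
    using invertible_det_nz invertible_left_inverse matrix_left_invertible_ker by metis
  define B where "B = {x. \<forall>n. f ((f ^^ n) x) \<noteq> (f ^^ n) x}"
  define v :: "real ^ 'a" where "v = (\<chi> x. indicator B x)"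
  have "f x \<in> B" if "x \<in> B" for x
    unfolding B_def
  proof (clarify)
    fix n assume "f ((f ^^ n) (f x)) = (f ^^ n) (f x)"
    then have "f ((f ^^ Suc n) x) = (f ^^ Suc n) x" by (simp add: funpow_swap1)
    then show False using that unfolding B_def by blast
  qed
  moreover have "x \<in> B" if "f x \<in> B" for x
    unfolding B_def
  proof (clarify)
    fix n assume n: "f ((f ^^ n) x) = (f ^^ n) x"
    then have "f ((f ^^ n) (f x)) = (f ^^ n) (f x)" by (simp add: funpow_swap1)
    then show False using that unfolding B_def by blast
  qed
  \<comment> \<open>So \<open>v\<close> is constant along \<open>f\<close> and is annihilated by the
    rows \<open>axis x 1 - axis (f x) 1\<close>; at fixed points \<open>v\<close> itself
    vanishes.\<close>
  ultimately have B: "f x \<in> B \<longleftrightarrow> x \<in> B" for x by blast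
  have fixed: "x \<notin> B" if "f x = x" for x
    using that by (auto simp: B_def intro!: exI[of _ 0])
  have "(map_matrix f *v v) $ x = 0" for x
  proof (cases "f x = x")
    case True
    have "(map_matrix f *v v) $ x = (\<Sum>y\<in>UNIV. map_matrix f $ x $ y * v $ y)"
      by (simp add: matrix_vector_mult_def)
    also have "\<dots> = (\<Sum>y\<in>UNIV. if x = y then v $ y else 0)"
      by (rule sum.cong) (use True in \<open>auto simp: map_matrix_nth\<close>)
    finally show ?thesis using fixed[OF True] by (simp add: v_def)
  next
    case False
    have "(map_matrix f *v v) $ x = (\<Sum>y\<in>UNIV. map_matrix f $ x $ y * v $ y)"
      by (simp add: matrix_vector_mult_def)
    also have "\<dots> = (\<Sum>y\<in>UNIV. (if x = y then v $ y else 0) - (if f x = y then v $ y else 0))"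
      by (rule sum.cong) (use False in \<open>auto simp: map_matrix_nth\<close>)
    finally show ?thesis using B[of x] by (simp add: v_def sum_subtractf indicator_def)
  qed
  then have "v = 0" by (intro ker[OF vec_eq_iff[THEN iffD2]]) simp
  have "x \<notin> B" for x
  proof -
    have "v $ x = 0" using \<open>v = 0\<close> by simp
    then show ?thesis by (simp add: v_def indicator_def split: if_splits)
  qed
  then show False using assms unfolding B_def rooted_map_def by blast
qed

lemma matrix_forest:
  "det (forest_matrix c) = (\<Sum>f | rooted_map f. \<Prod>x\<in>UNIV. c x (f x))"
proof -
  \<comment> \<open>\<open>b x (f x)\<close> is row \<open>x\<close> of \<open>map_matrix f\<close>,
    which is what multilinearity in the rows will produce.\<close>
  define b :: "'a \<Rightarrow> 'a \<Rightarrow> real ^ 'a" where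
    "b x y = (if y = x then axis x 1 else axis x 1 - axis y 1)" for x y
  have "(\<Sum>y\<in>UNIV. c x y *s b x y) $ z = forest_matrix c $ x $ z" for x z
  proof -
    have "(\<Sum>y\<in>UNIV. c x y *s b x y) $ z =
      (\<Sum>y\<in>UNIV. (if x = z then c x y else 0) - (if y = z then (if x = z then 0 else c x y) else 0))"
      unfolding sum_component by (rule sum.cong) (auto simp: b_def axis_def)
    then show ?thesis by (simp add: sum_subtractf forest_matrix_def)
  qed
  then have "forest_matrix c = (\<chi> x. \<Sum>y\<in>UNIV. c x y *s b x y)"
    by (simp add: vec_eq_iff)
  then have "det (forest_matrix c) = (\<Sum>f\<in>UNIV. det (\<chi> x. c x (f x) *s b x (f x)))"
    by (simp add: det_linear_rows_sum)
  also have "\<dots> = (\<Sum>f\<in>UNIV. (\<Prod>x\<in>UNIV. c x (f x)) * det (map_matrix f))"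
    by (simp add: det_rows_mul b_def map_matrix_def)
  also have "\<dots> = (\<Sum>f\<in>UNIV. if rooted_map f then \<Prod>x\<in>UNIV. c x (f x) else 0)"
    by (intro sum.cong refl) (simp add: det_map_matrix_rooted det_map_matrix_not_rooted)
  also have "\<dots> = (\<Sum>f | rooted_map f. \<Prod>x\<in>UNIV. c x (f x))"
    by (simp add: sum.If_cases)
  finally show ?thesis .
qed

section \<open>Minors of the kernel\<close>

lemma det_on_eq_det:
  fixes K :: "'a::finite \<Rightarrow> 'a \<Rightarrow> real"
  shows "det_on A K = det (\<chi> x y. if y \<in> A then K x y else if x = y then 1 else 0)"
proof -
  let ?M = "\<chi> x y. if y \<in> A then K x y else if x = y then 1 else 0 :: real ^ 'a ^ 'a"
  \<comment> \<open>A unit column is nonzero only on the diagonal, so a contributing permutation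
    fixes every point outside \<open>A\<close>.\<close>
  have zero: "(\<Prod>x\<in>UNIV. ?M $ x $ p x) = 0" if p: "p permutes UNIV" "\<not> p permutes A" for p
  proof -
    have "\<exists>y. y \<notin> A \<and> p y \<noteq> y"
      using p unfolding permutes_def by auto
    then obtain y where y: "y \<notin> A" "p y \<noteq> y" by blast
    define x where "x = inv p y"
    have "p x = y" using p(1) by (simp add: x_def permutes_inverses)
    then have "?M $ x $ p x = 0" using y by auto
    then show ?thesis by (meson UNIV_I finite_class.finite_UNIV prod_zero_iff)
  qed
  have eq: "(\<Prod>x\<in>UNIV. ?M $ x $ p x) = (\<Prod>x\<in>A. K x (p x))" if p: "p permutes A" for p
  proof -
    have "(\<Prod>x\<in>A. ?M $ x $ p x) = (\<Prod>x\<in>UNIV. ?M $ x $ p x)"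
      by (rule prod.mono_neutral_left) (use p in \<open>auto simp: permutes_not_in\<close>)
    moreover have "(\<Prod>x\<in>A. ?M $ x $ p x) = (\<Prod>x\<in>A. K x (p x))"
      by (rule prod.cong) (use p in \<open>auto simp: permutes_in_image\<close>)
    ultimately show ?thesis by simp
  qed
  have "det ?M = (\<Sum>p | p permutes A. of_int (sign p) * (\<Prod>x\<in>UNIV. ?M $ x $ p x))"
    unfolding det_def
    by (rule sum.mono_neutral_right) (use zero in \<open>auto intro: permutes_subset\<close>)
  also have "\<dots> = det_on A K" unfolding det_on_def by (rule sum.cong) (simp_all add: eq del: vec_lambda_beta)
  finally show ?thesis by simp
qed

text \<open>Either determinant sees only permutations that fix \<open>A\<close> pointwise, and for
  these the two products coincide. This trades prescribed columns for prescribed rows, and the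
  latter are again rows of a forest matrix.\<close>

lemma det_diagonal_columns_eq_rows:
  fixes D :: "'a::finite \<Rightarrow> 'a \<Rightarrow> real"
  shows "det (\<chi> x y. if y \<in> A then (if x = y then r y else 0) else D x y) =
    det (\<chi> x y. if x \<in> A then (if x = y then r x else 0) else D x y)"
  (is "det ?M = det ?N")
proof -
  have "(\<Prod>x\<in>UNIV. ?M $ x $ p x) = (\<Prod>x\<in>UNIV. ?N $ x $ p x)" if p: "p permutes UNIV" for p
  proof (cases "\<forall>x\<in>A. p x = x")
    case True
    then have "p x \<in> A \<longleftrightarrow> x \<in> A" for x using permutes_inj[OF p] by (metis injD)
    then show ?thesis by (intro prod.cong refl) auto
  next
    case False
    then obtain y where y: "y \<in> A" "p y \<noteq> y" by blast
    define x where "x = inv p y"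
    have "p x = y" using p by (simp add: x_def permutes_inverses)
    then have "?M $ x $ p x = 0" using y by auto
    moreover have "?N $ y $ p y = 0" using y by auto
    ultimately show ?thesis by (metis (no_types, lifting) UNIV_I finite_class.finite_UNIV prod_zero_iff)
  qed
  then show ?thesis unfolding det_def by (intro sum.cong refl) auto
qed

text \<open>Replacing the columns of \<open>K\<close> outside \<open>A\<close> by unit vectors before multiplying by the forest
  matrix gives \<open>det\<^sub>A K\<close> without inverting any submatrix.\<close>

lemma rooted_map_sum_eq_det_on:
  fixes c K :: "'a::finite \<Rightarrow> 'a \<Rightarrow> real"
  assumes K: "forest_matrix c ** (\<chi> x y. K x y) = (\<chi> x y. if x = y then c x x else 0)"
  shows "(\<Sum>f | rooted_map f \<and> (\<forall>x\<in>A. f x = x). \<Prod>x\<in>UNIV. c x (f x)) =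
    det (forest_matrix c) * det_on A K"
proof -
  \<comment> \<open>\<open>c'\<close> deletes all arrows out of \<open>A\<close> and keeps the root
    weights, so forests of nonzero weight have \<open>A\<close> among their roots. Its matrix has
    exactly the diagonal rows on \<open>A\<close> that the product will leave.\<close>
  define c' where "c' x y = (if x \<in> A \<and> y \<noteq> x then 0 else c x y)" for x y
  define D where "D x y = forest_matrix c $ x $ y" for x y
  let ?KA = "\<chi> x y. if y \<in> A then K x y else if x = y then 1 else 0 :: real ^ 'a ^ 'a"
  have "(forest_matrix c ** ?KA) $ x $ y =
    (if y \<in> A then (if x = y then c y y else 0) else D x y)" for x y
  proof (cases "y \<in> A")
    case True
    have "(forest_matrix c ** ?KA) $ x $ y = (forest_matrix c ** (\<chi> x y. K x y)) $ x $ y"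
      using True by (simp add: matrix_matrix_mult_def)
    then show ?thesis using True K by auto
  next
    case False
    have "(forest_matrix c ** ?KA) $ x $ y = (\<Sum>z\<in>UNIV. D x z * ?KA $ z $ y)"
      by (simp add: matrix_matrix_mult_def D_def)
    also have "\<dots> = (\<Sum>z\<in>UNIV. if z = y then D x z else 0)"
      by (rule sum.cong) (use False in auto)
    finally show ?thesis using False by simp
  qed
  then have "forest_matrix c ** ?KA =
    (\<chi> x y. if y \<in> A then (if x = y then c y y else 0) else D x y)"
    by (simp add: vec_eq_iff)
  then have "det (forest_matrix c) * det_on A K =
    det (\<chi> x y. if y \<in> A then (if x = y then c y y else 0) else D x y)"
    by (simp only: det_on_eq_det det_mul[symmetric])
  also have "\<dots> = det (\<chi> x y. if x \<in> A then (if x = y then c x x else 0) else D x y)"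
    by (rule det_diagonal_columns_eq_rows)
  also have "(\<chi> x y. if x \<in> A then (if x = y then c x x else 0) else D x y) = forest_matrix c'"
  proof -
    have "(\<Sum>z\<in>UNIV. c' x z) = c x x" if "x \<in> A" for x
    proof -
      have "(\<Sum>z\<in>UNIV. c' x z) = (\<Sum>z\<in>UNIV. if z = x then c x z else 0)"
        by (rule sum.cong) (use that in \<open>auto simp: c'_def\<close>)
      then show ?thesis by simp
    qed
    moreover have "c' x = c x" if "x \<notin> A" for x using that by (auto simp: c'_def)
    ultimately show ?thesis
      by (auto simp: vec_eq_iff forest_matrix_def D_def c'_def)
  qed
  also have "det (forest_matrix c') = (\<Sum>f | rooted_map f. \<Prod>x\<in>UNIV. c' x (f x))"
    by (rule matrix_forest)
  also have "\<dots> = (\<Sum>f | rooted_map f \<and> (\<forall>x\<in>A. f x = x). \<Prod>x\<in>UNIV. c' x (f x))"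
    by (rule sum.mono_neutral_right) (auto simp: c'_def)
  also have "\<dots> = (\<Sum>f | rooted_map f \<and> (\<forall>x\<in>A. f x = x). \<Prod>x\<in>UNIV. c x (f x))"
    by (intro sum.cong prod.cong refl) (auto simp: c'_def)
  finally show ?thesis by simp
qed

section \<open>The forest measure\<close>

text \<open>At a point of infinite rate, root weight \<open>1\<close> leaves the point out of the
  product over roots, and weight \<open>0\<close> for every other choice encodes that it must be a
  root.\<close>

definition step_weight :: "('a \<Rightarrow> 'a \<Rightarrow> real) \<Rightarrow> ('a \<Rightarrow> ennreal) \<Rightarrow> 'a \<Rightarrow> 'a \<Rightarrow> real" where
  "step_weight w q x y =
     (if q x = \<infinity> then (if y = x then 1 else 0) else if y = x then enn2real (q x) else w x y)"

lemma killed_forest_weight_map_edges: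
  fixes f :: "'a::finite \<Rightarrow> 'a"
  shows "killed_forest_weight w q (map_edges f) = (\<Prod>x\<in>UNIV. step_weight w q x (f x))"
proof -
  define S where "S = infinite_killing q"
  have S: "q x = \<infinity> \<longleftrightarrow> x \<in> S" for x by (simp add: S_def infinite_killing_def)
  have me: "map_edges f = (\<lambda>x. (x, f x)) ` {x. f x \<noteq> x}" by (auto simp: map_edges_def)
  have fw: "forest_weight w (map_edges f) = (\<Prod>x | f x \<noteq> x. w x (f x))"
    unfolding forest_weight_def me by (subst prod.reindex) (auto simp: inj_on_def)
  show ?thesis
  proof (cases "S \<subseteq> {x. f x = x}")
    case True
    have "(\<Prod>x\<in>UNIV. step_weight w q x (f x)) =
      (\<Prod>x | f x \<noteq> x. step_weight w q x (f x)) * (\<Prod>x | f x = x. step_weight w q x (f x))"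
      by (subst prod.union_disjoint[symmetric]) (auto intro!: prod.cong)
    also have "(\<Prod>x | f x \<noteq> x. step_weight w q x (f x)) = (\<Prod>x | f x \<noteq> x. w x (f x))"
      by (rule prod.cong) (use True in \<open>auto simp: step_weight_def S[simplified]\<close>)
    also have "(\<Prod>x | f x = x. step_weight w q x (f x)) = (\<Prod>x\<in>{x. f x = x} - S. enn2real (q x))"
      by (rule prod.mono_neutral_cong_right) (auto simp: step_weight_def S[simplified])
    finally show ?thesis
      using True by (simp add: killed_forest_weight_def fw roots_map_edges S_def)
  next
    case False
    then obtain x where x: "x \<in> S" "f x \<noteq> x" by blast
    then have "step_weight w q x (f x) = 0" by (simp add: step_weight_def S[simplified])
    then have "(\<Prod>x\<in>UNIV. step_weight w q x (f x)) = 0"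
      by (meson UNIV_I finite_class.finite_UNIV prod_zero_iff)
    then show ?thesis using False by (simp add: killed_forest_weight_def roots_map_edges S_def)
  qed
qed

text \<open>An edge between distinct points outside \<open>rate_edges w\<close> has rate zero by
  nonnegativity, so forests that use one may be added to the sum. It then ranges over all spanning
  rooted forests and is reindexed by rooted maps.\<close>

lemma sum_killed_forest_weight:
  fixes w :: "'a::finite \<Rightarrow> 'a \<Rightarrow> real"
  assumes w: "\<And>x y. w x y \<ge> 0"
  shows "(\<Sum>\<phi> | \<phi> \<in> forests w \<and> A \<subseteq> roots \<phi>. killed_forest_weight w q \<phi>) =
    (\<Sum>f | rooted_map f \<and> (\<forall>x\<in>A. f x = x). \<Prod>x\<in>UNIV. step_weight w q x (f x))"
proof -
  have zero: "killed_forest_weight w q \<phi> = 0" if \<phi>: "\<not> \<phi> \<subseteq> rate_edges w" "\<And>x. (x, x) \<notin> \<phi>" for \<phi>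
  proof -
    obtain x y where xy: "(x, y) \<in> \<phi>" "(x, y) \<notin> rate_edges w"
      using \<phi>(1) by auto
    moreover have "x \<noteq> y" using xy(1) \<phi>(2) by auto
    ultimately have "\<not> w x y > 0" by (simp add: rate_edges_def)
    then have "w x y = 0" using w[of x y] by simp
    then have "forest_weight w \<phi> = 0"
      unfolding forest_weight_def using xy(1) by (auto intro!: bexI[of _ "(x, y)"])
    then show ?thesis by (simp add: killed_forest_weight_def)
  qed
  have "(\<Sum>\<phi> | \<phi> \<in> forests w \<and> A \<subseteq> roots \<phi>. killed_forest_weight w q \<phi>) =
    (\<Sum>\<phi> | spanning_rooted_forest \<phi> \<and> A \<subseteq> roots \<phi>. killed_forest_weight w q \<phi>)"
  proof (rule sum.mono_neutral_left)
    show "\<forall>\<phi>\<in>{\<phi>. spanning_rooted_forest \<phi> \<and> A \<subseteq> roots \<phi>} - {\<phi>. \<phi> \<in> forests w \<and> A \<subseteq> roots \<phi>}.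
      killed_forest_weight w q \<phi> = 0"
    proof
      fix \<phi> assume "\<phi> \<in> {\<phi>. spanning_rooted_forest \<phi> \<and> A \<subseteq> roots \<phi>} - {\<phi>. \<phi> \<in> forests w \<and> A \<subseteq> roots \<phi>}"
      then have \<phi>: "spanning_rooted_forest \<phi>" "\<not> \<phi> \<subseteq> rate_edges w" by (auto simp: forests_def)
      obtain f where "\<phi> = map_edges f" using spanning_rooted_forest_imp_map[OF \<phi>(1)] by blast
      then show "killed_forest_weight w q \<phi> = 0" using zero[OF \<phi>(2)] by auto
    qed
  qed (auto simp: forests_def)
  also have "{\<phi>. spanning_rooted_forest \<phi> \<and> A \<subseteq> roots \<phi>} =
    map_edges ` {f. rooted_map f \<and> (\<forall>x\<in>A. f x = x)}"
  proof (intro set_eqI iffI)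
    fix \<phi> :: "('a \<times> 'a) set" assume \<phi>: "\<phi> \<in> {\<phi>. spanning_rooted_forest \<phi> \<and> A \<subseteq> roots \<phi>}"
    then obtain f where "rooted_map f" "\<phi> = map_edges f"
      using spanning_rooted_forest_imp_map by blast
    then show "\<phi> \<in> map_edges ` {f. rooted_map f \<and> (\<forall>x\<in>A. f x = x)}"
      using \<phi> by (auto simp: roots_map_edges)
  qed (auto simp: roots_map_edges spanning_rooted_forest_map_edges)
  also have "(\<Sum>\<phi>\<in>\<dots>. killed_forest_weight w q \<phi>) =
    (\<Sum>f | rooted_map f \<and> (\<forall>x\<in>A. f x = x). killed_forest_weight w q (map_edges f))"
    by (subst sum.reindex) (auto intro: inj_on_subset[OF inj_map_edges])
  finally show ?thesis by (simp add: killed_forest_weight_map_edges)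
qed

text \<open>Maximum principle: for \<open>v\<close> in the kernel with positive maximum, the row at
  a maximiser is a vanishing sum of nonnegative terms. So its root weight is zero and its neighbours
  are maximisers too; irreducibility spreads this to all points, against \<open>q x > 0\<close>
  somewhere. Applied to \<open>v\<close> and \<open>- v\<close>.\<close>

lemma det_forest_matrix_nonzero:
  fixes w :: "'a::finite \<Rightarrow> 'a \<Rightarrow> real"
  assumes w: "\<And>x y. w x y \<ge> 0" and irr: "irreducible_rates w" and q: "\<exists>x. q x > 0"
  shows "det (forest_matrix (step_weight w q)) \<noteq> 0"
proof -
  let ?c = "step_weight w q"
  have row: "(forest_matrix ?c *v v) $ x = ?c x x * v $ x + (\<Sum>z\<in>UNIV. ?c x z * (v $ x - v $ z))" for v x
    using forest_matrix_mult[of ?c x "($) v"]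
    by (simp add: matrix_vector_mult_def generator_def right_diff_distrib sum_subtractf)
  have c0: "?c x y \<ge> 0" for x y using w by (simp add: step_weight_def)
  have nonpos: "v $ y \<le> 0" if v: "forest_matrix ?c *v v = 0" for v y
  proof (rule ccontr)
    assume "\<not> v $ y \<le> 0"
    define m where "m = Max (range (($) v))"
    have le: "v $ z \<le> m" for z unfolding m_def by (rule Max_ge) auto
    have m: "m > 0" using le[of y] \<open>\<not> v $ y \<le> 0\<close> by linarith
    have max_step: "?c x x = 0 \<and> (\<forall>z. z \<noteq> x \<longrightarrow> ?c x z > 0 \<longrightarrow> v $ z = m)" if x: "v $ x = m" for x
    proof -
      have "?c x x * m + (\<Sum>z\<in>UNIV. ?c x z * (m - v $ z)) = 0"
        using row[of v x] v x by simp
      moreover have "?c x x * m \<ge> 0" using c0 m by simp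
      moreover have nn: "?c x z * (m - v $ z) \<ge> 0" for z using c0[of x z] le[of z] by simp
      then have "(\<Sum>z\<in>UNIV. ?c x z * (m - v $ z)) \<ge> 0" by (intro sum_nonneg)
      ultimately have "?c x x * m = 0" "(\<Sum>z\<in>UNIV. ?c x z * (m - v $ z)) = 0" by linarith+
      then have "?c x x = 0" "\<forall>z. ?c x z * (m - v $ z) = 0"
        using m nn by (simp_all add: sum_nonneg_eq_0_iff)
      then show ?thesis by force
    qed
    have "m \<in> range (($) v)" unfolding m_def by (rule Max_in) auto
    then obtain x0 where x0: "v $ x0 = m" by auto
    have all: "v $ z = m" for z
    proof -
      have "(x0, z) \<in> (rate_edges w)\<^sup>*" using irr by (simp add: irreducible_rates_def)
      then show ?thesis
      proof (induction rule: rtrancl_induct)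
        case base
        show ?case by (rule x0)
      next
        case (step a b)
        from \<open>v $ a = m\<close> have "?c a a = 0" using max_step by blast
        \<comment> \<open>An infinite rate would mean root weight \<open>1\<close>, so at a
          maximiser the outgoing weights are the rates \<open>w\<close>.\<close>
        then have "q a \<noteq> \<infinity>" by (auto simp: step_weight_def)
        then have "?c a b > 0" "b \<noteq> a" using step(2) by (auto simp: step_weight_def rate_edges_def)
        then show ?case using \<open>v $ a = m\<close> max_step by blast
      qed
    qed
    obtain x where "q x > 0" using q by blast
    then have "?c x x > 0" by (auto simp: step_weight_def enn2real_positive_iff less_top)
    then show False using max_step[OF all[of x]] by simp
  qed
  have "v = 0" if v: "forest_matrix ?c *v v = 0" for v
  proof -
    have "forest_matrix ?c *v (- v) = 0" using v
      by (simp add: matrix_vector_mult_def vec_eq_iff sum_negf)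
    then have "v $ y = 0" for y using nonpos[of "- v" y] nonpos[OF v, of y] by simp
    then show ?thesis by (simp add: vec_eq_iff)
  qed
  then show ?thesis
    using invertible_det_nz invertible_left_inverse matrix_left_invertible_ker by metis
qed

lemma prob_subset_roots:
  fixes w :: "'a::finite \<Rightarrow> 'a \<Rightarrow> real" and \<Phi> :: "'v \<Rightarrow> ('a \<times> 'a) set"
  assumes w: "\<And>x y. w x y \<ge> 0" and irr: "irreducible_rates w" and q: "\<exists>x. q x > 0"
    and N: "prob_space N" and \<Phi>: "\<Phi> \<in> measurable N (count_space (forests w))"
    and law: "\<And>\<phi>. \<phi> \<in> forests w \<Longrightarrow> measure N {\<eta> \<in> space N. \<Phi> \<eta> = \<phi>} = forest_law w q \<phi>"
    and K: "forest_matrix (step_weight w q) ** (\<chi> x y. K x y) =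
      (\<chi> x y. if x = y then step_weight w q x x else 0)"
  shows "measure N {\<eta> \<in> space N. A \<subseteq> roots (\<Phi> \<eta>)} = det_on A K"
proof -
  interpret prob_space N by (rule N)
  let ?F = "{\<phi>. \<phi> \<in> forests w \<and> A \<subseteq> roots \<phi>}"
  have meas: "{\<eta> \<in> space N. \<Phi> \<eta> = \<phi>} \<in> sets N" if "\<phi> \<in> forests w" for \<phi>
  proof -
    have "\<Phi> -` {\<phi>} \<inter> space N \<in> sets N" using \<Phi> that by (intro measurable_sets) auto
    then show ?thesis by (simp add: vimage_def Int_def conj_commute)
  qed
  have "{\<eta> \<in> space N. A \<subseteq> roots (\<Phi> \<eta>)} = (\<Union>\<phi>\<in>?F. {\<eta> \<in> space N. \<Phi> \<eta> = \<phi>})"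
    using measurable_space[OF \<Phi>] by auto
  then have "measure N {\<eta> \<in> space N. A \<subseteq> roots (\<Phi> \<eta>)} = (\<Sum>\<phi>\<in>?F. measure N {\<eta> \<in> space N. \<Phi> \<eta> = \<phi>})"
    by (simp only:) (rule finite_measure_finite_Union, use meas in \<open>auto simp: disjoint_family_on_def\<close>)
  also have "\<dots> = (\<Sum>\<phi>\<in>?F. killed_forest_weight w q \<phi>) / forest_partition_function w q"
    by (simp add: law forest_law_def sum_divide_distrib)
  also have "(\<Sum>\<phi>\<in>?F. killed_forest_weight w q \<phi>) = det (forest_matrix (step_weight w q)) * det_on A K"
    by (simp add: sum_killed_forest_weight[OF w] rooted_map_sum_eq_det_on[OF K])
  also have "forest_partition_function w q = det (forest_matrix (step_weight w q))"
    using sum_killed_forest_weight[OF w, where A = "{}" and q = q]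
    by (simp add: forest_partition_function_def matrix_forest)
  finally show ?thesis using det_forest_matrix_nonzero[OF w irr q] by simp
qed

section \<open>Paths and their accumulated killing rate\<close>

text \<open>The path is sampled at countably many grid times; by right continuity, samples taken
  slightly to the right are eventually exact. \<open>max s 0\<close> extends the map to negative
  times, where nothing is assumed about \<open>Y\<close>.\<close>

lemma right_continuous_measurable_pair:
  fixes Y :: "real \<Rightarrow> 'w \<Rightarrow> 'a::finite"
  assumes Y: "\<And>t. 0 \<le> t \<Longrightarrow> Y t \<in> measurable M (count_space UNIV)"
    and right: "\<And>\<omega> t. \<omega> \<in> space M \<Longrightarrow> 0 \<le> t \<Longrightarrow> eventually (\<lambda>s. Y s \<omega> = Y t \<omega>) (at_right t)"
  shows "(\<lambda>(s, \<omega>). Y (max s 0) \<omega>) \<in> measurable (borel \<Otimes>\<^sub>M M) (count_space UNIV)"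
proof -
  define k where "k n s = nat \<lfloor>max s 0 * real (Suc n)\<rfloor>" for n and s :: real
  \<comment> \<open>\<open>Suc (k n s)\<close> places the sampling time strictly to the right of
    \<open>max s 0\<close>, at distance at most \<open>1 / real (Suc n)\<close>.\<close>
  define Z where "Z n z = Y (real (Suc (k n (fst z))) / real (Suc n)) (snd z)" for n and z :: "real \<times> 'w"
  have k [measurable]: "k n \<in> measurable borel (count_space UNIV)" for n unfolding k_def by measurable
  have Z [measurable]: "Z n \<in> measurable (borel \<Otimes>\<^sub>M M) (count_space UNIV)" for n
  proof -
    have "(\<lambda>z. Y (real (Suc i) / real (Suc n)) (snd z)) \<in> measurable (borel \<Otimes>\<^sub>M M) (count_space UNIV)" for i
      by (rule measurable_compose[OF measurable_snd Y]) simp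
    moreover have "(\<lambda>z. k n (fst z)) \<in> measurable (borel \<Otimes>\<^sub>M M) (count_space UNIV)" by measurable
    ultimately show ?thesis unfolding Z_def by (rule measurable_compose_countable)
  qed
  have lim: "eventually (\<lambda>n. Z n (s, \<omega>) = Y (max s 0) \<omega>) sequentially" if \<omega>: "\<omega> \<in> space M" for s \<omega>
  proof -
    define t where "t = max s 0"
    have t: "t \<ge> 0" by (simp add: t_def)
    obtain b where b: "b > t" "\<And>s. t < s \<Longrightarrow> s < b \<Longrightarrow> Y s \<omega> = Y t \<omega>"
      using right[OF \<omega> t] unfolding eventually_at_right_field by blast
    have "(\<lambda>n. inverse (real (Suc n))) \<longlonglongrightarrow> 0" by (rule LIMSEQ_inverse_real_of_nat)
    then have "eventually (\<lambda>n. inverse (real (Suc n)) < b - t) sequentially"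
      using b(1) by (intro order_tendstoD) auto
    then show ?thesis
    proof eventually_elim
      case (elim n)
      let ?r = "real (Suc (k n s)) / real (Suc n)"
      have kk: "real (k n s) = of_int \<lfloor>t * real (Suc n)\<rfloor>" using t by (simp add: k_def t_def)
      have 1: "real (k n s) \<le> t * real (Suc n)" "t * real (Suc n) < real (k n s) + 1"
        unfolding kk by linarith+
      have "t * real (Suc n) / real (Suc n) < ?r" using 1(2) by (intro divide_strict_right_mono) auto
      then have "t < ?r" by simp
      moreover have "?r \<le> (t * real (Suc n) + 1) / real (Suc n)" using 1(1) by (intro divide_right_mono) auto
      then have "?r \<le> t + inverse (real (Suc n))"
        by (simp add: add_divide_distrib inverse_eq_divide del: of_nat_Suc)
      ultimately show ?case using b(2) elim by (simp add: Z_def t_def)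
    qed
  qed
  have "(\<lambda>z. Y (max (fst z) 0) (snd z)) \<in> measurable (borel \<Otimes>\<^sub>M M) (count_space UNIV)"
  proof (subst measurable_count_space_eq2_countable, safe)
    fix y
    have iff: "Y (max s 0) \<omega> = y \<longleftrightarrow> (\<exists>N. \<forall>n\<ge>N. Z n (s, \<omega>) = y)" if \<omega>: "\<omega> \<in> space M" for s \<omega>
    proof -
      obtain N where N: "\<And>n. n \<ge> N \<Longrightarrow> Z n (s, \<omega>) = Y (max s 0) \<omega>"
        using lim[OF \<omega>] unfolding eventually_sequentially by blast
      show ?thesis using N by (metis nle_le)
    qed
    have "(\<lambda>z. Y (max (fst z) 0) (snd z)) -` {y} \<inter> space (borel \<Otimes>\<^sub>M M) =
      {z \<in> space (borel \<Otimes>\<^sub>M M). Y (max (fst z) 0) (snd z) = y}" by auto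
    also have "\<dots> = {z \<in> space (borel \<Otimes>\<^sub>M M). \<exists>N. \<forall>n\<ge>N. Z n z = y}"
    proof (rule Collect_cong, rule conj_cong[OF refl])
      fix z :: "real \<times> 'w" assume "z \<in> space (borel \<Otimes>\<^sub>M M)"
      then show "Y (max (fst z) 0) (snd z) = y \<longleftrightarrow> (\<exists>N. \<forall>n\<ge>N. Z n z = y)"
        using iff[of "snd z" "fst z"] by (simp add: space_pair_measure mem_Times_iff)
    qed
    also have "\<dots> \<in> sets (borel \<Otimes>\<^sub>M M)" by measurable
    finally show "(\<lambda>z. Y (max (fst z) 0) (snd z)) -` {y} \<inter> space (borel \<Otimes>\<^sub>M M) \<in> sets (borel \<Otimes>\<^sub>M M)" .
  qed auto
  then show ?thesis by (simp add: case_prod_beta')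
qed

section \<open>Killing of a single path, in continuous time and on a grid\<close>

definition accumulated_rate :: "('a \<Rightarrow> ennreal) \<Rightarrow> (real \<Rightarrow> 'a) \<Rightarrow> real \<Rightarrow> ennreal" where
  "accumulated_rate q \<xi> t = (\<integral>\<^sup>+ s\<in>{0..t}. q (\<xi> s) \<partial>lborel)"

text \<open>Left-endpoint Riemann sum of mesh \<open>1 / real (Suc m)\<close> for
  \<open>accumulated_rate\<close>; it includes the observations \<open>0\<close> to
  \<open>n - 1\<close> and not the \<open>n\<close>-th.\<close>

definition grid_rate :: "('a \<Rightarrow> ennreal) \<Rightarrow> (real \<Rightarrow> 'a) \<Rightarrow> nat \<Rightarrow> nat \<Rightarrow> ennreal" where
  "grid_rate q \<xi> m n = (\<Sum>j<n. ennreal (1 / real (Suc m)) * q (\<xi> (real j / real (Suc m))))"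

text \<open>A one-point sample space turns the path into a process, so that
  \<open>killing_time\<close> applies to it.\<close>

definition killed_at :: "('a \<Rightarrow> ennreal) \<Rightarrow> (real \<Rightarrow> 'a) \<Rightarrow> real \<Rightarrow> 'a \<Rightarrow> bool" where
  "killed_at q \<xi> u y \<longleftrightarrow> killing_time (\<lambda>t _. \<xi> t) q () u < \<infinity> \<and>
     \<xi> (real_of_ereal (killing_time (\<lambda>t _. \<xi> t) q () u)) = y"

text \<open>Observation \<open>n\<close> is the one whose summand lifts the grid rate to level
  \<open>u\<close>. An infinite rate makes that summand infinite, so \<open>infinite_killing\<close>
  is covered without a clause of its own.\<close>

definition grid_killed_at :: "('a \<Rightarrow> ennreal) \<Rightarrow> (real \<Rightarrow> 'a) \<Rightarrow> real \<Rightarrow> nat \<Rightarrow> nat \<Rightarrow> 'a \<Rightarrow> bool" where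
  "grid_killed_at q \<xi> u m n y \<longleftrightarrow>
     grid_rate q \<xi> m n < ennreal u \<and> ennreal u \<le> grid_rate q \<xi> m (Suc n) \<and> \<xi> (real n / real (Suc m)) = y"

lemma grid_rate_mono: "n \<le> n' \<Longrightarrow> grid_rate q \<xi> m n \<le> grid_rate q \<xi> m n'"
  unfolding grid_rate_def by (rule sum_mono2) auto

text \<open>Rounding up makes the sampled state tend to \<open>\<xi> s\<close> by right continuity
  at every \<open>s\<close>; rounding down could see the left limit at a jump.\<close>

definition ceiling_grid :: "nat \<Rightarrow> real \<Rightarrow> real" where
  "ceiling_grid m s = of_int \<lceil>s * real (Suc m)\<rceil> / real (Suc m)"

lemma ceiling_grid_bounds:
  shows ceiling_grid_ge: "s \<le> ceiling_grid m s"
    and ceiling_grid_less: "ceiling_grid m s < s + inverse (real (Suc m))"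
proof -
  let ?N = "real (Suc m)"
  have "s * ?N \<le> of_int \<lceil>s * ?N\<rceil>" "of_int \<lceil>s * ?N\<rceil> < s * ?N + 1" by linarith+
  then have "s * ?N / ?N \<le> ceiling_grid m s" "ceiling_grid m s < (s * ?N + 1) / ?N"
    unfolding ceiling_grid_def by (intro divide_right_mono divide_strict_right_mono; simp)+
  then show "s \<le> ceiling_grid m s" "ceiling_grid m s < s + inverse ?N"
    by (simp_all add: add_divide_distrib inverse_eq_divide del: of_nat_Suc)
qed

locale cadlag_path =
  fixes \<xi> :: "real \<Rightarrow> 'a::finite" and q :: "'a \<Rightarrow> ennreal"
  assumes right: "0 \<le> t \<Longrightarrow> eventually (\<lambda>s. \<xi> s = \<xi> t) (at_right t)"
    and left: "0 < t \<Longrightarrow> \<exists>y. eventually (\<lambda>s. \<xi> s = y) (at_left t)"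
begin

abbreviation A :: "real \<Rightarrow> ennreal" where "A \<equiv> accumulated_rate q \<xi>"

lemma right_const:
  assumes "0 \<le> t"
  obtains b where "b > t" "\<And>s. t \<le> s \<Longrightarrow> s < b \<Longrightarrow> \<xi> s = \<xi> t"
proof -
  obtain b where "b > t" "\<And>s. t < s \<Longrightarrow> s < b \<Longrightarrow> \<xi> s = \<xi> t"
    using right[OF assms] unfolding eventually_at_right_field by blast
  then show ?thesis using that[of b] by (metis order_le_less)
qed

lemma left_const:
  assumes "0 < t"
  obtains a y where "0 \<le> a" "a < t" "\<And>s. a \<le> s \<Longrightarrow> s < t \<Longrightarrow> \<xi> s = y"
proof -
  obtain y where "eventually (\<lambda>s. \<xi> s = y) (at_left t)" using left[OF assms] by blast
  then obtain b where b: "b < t" "\<And>s. b < s \<Longrightarrow> s < t \<Longrightarrow> \<xi> s = y"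
    unfolding eventually_at_left_field by blast
  define a where "a = max 0 ((b + t) / 2)"
  have "b < a" unfolding a_def using b(1) by (auto simp: less_max_iff_disj)
  then show ?thesis using that[of a y] b assms by (auto simp: a_def)
qed

lemma measurable_path: "(\<lambda>s. \<xi> (max s 0)) \<in> measurable borel (count_space UNIV)"
proof -
  have "(\<lambda>(s, \<omega>). \<xi> (max s 0)) \<in> measurable (borel \<Otimes>\<^sub>M count_space {()}) (count_space UNIV)"
    by (rule right_continuous_measurable_pair) (auto simp: right)
  then have "(\<lambda>s. case (s, ()) of (s, \<omega>) \<Rightarrow> \<xi> (max s 0)) \<in> measurable borel (count_space UNIV)"
    by (rule measurable_compose[rotated]) measurable
  then show ?thesis by simp
qed

lemma measurable_rate [measurable]: "(\<lambda>s. q (\<xi> (max s 0))) \<in> borel_measurable borel"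
  by (rule measurable_compose[OF measurable_path]) simp

lemma A_eq: "A t = (\<integral>\<^sup>+ s. q (\<xi> (max s 0)) * indicator {0..t} s \<partial>lborel)"
  unfolding accumulated_rate_def by (intro nn_integral_cong) (auto simp: indicator_def max_def)

lemma A_mono: "s \<le> t \<Longrightarrow> A s \<le> A t"
  unfolding accumulated_rate_def
  by (intro nn_integral_mono mult_left_mono) (auto simp: indicator_def)

lemma A_0: "A 0 = 0"
proof -
  have "AE s in lborel. q (\<xi> s) * indicator {0..0} s = 0"
    using AE_lborel_singleton[of "0::real"] by eventually_elim (auto simp: indicator_def)
  then show ?thesis unfolding accumulated_rate_def by (simp add: nn_integral_zero')
qed

lemma A_const:
  assumes ab: "0 \<le> a" "a \<le> b" and c: "\<And>s. a \<le> s \<Longrightarrow> s < b \<Longrightarrow> \<xi> s = y"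
  shows "A b = A a + q y * ennreal (b - a)"
proof -
  have "A b = (\<integral>\<^sup>+ s. q (\<xi> (max s 0)) * indicator {0..a} s + q y * indicator {a<..<b} s \<partial>lborel)"
    unfolding A_eq
  proof (rule nn_integral_cong_AE)
    show "AE s in lborel. q (\<xi> (max s 0)) * indicator {0..b} s =
      q (\<xi> (max s 0)) * indicator {0..a} s + q y * indicator {a<..<b} s"
      using AE_lborel_singleton[of b]
      by eventually_elim (use ab c in \<open>auto simp: indicator_def max_def\<close>)
  qed
  also have "\<dots> = A a + q y * emeasure lborel {a<..<b}"
    by (subst nn_integral_add) (auto simp: A_eq nn_integral_cmult_indicator)
  finally show ?thesis using ab by simp
qed

text \<open>\<open>A\<close> has the form of \<open>A_const\<close> just before \<open>t\<close>, so
  it is continuous from the left, even where it is infinite. From the right it may jump to infinity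
  on entering a point of infinite rate.\<close>

lemma A_left_le:
  assumes t: "0 < t" and c: "\<And>s. 0 \<le> s \<Longrightarrow> s < t \<Longrightarrow> A s \<le> c"
  shows "A t \<le> c"
proof -
  obtain a y where a: "0 \<le> a" "a < t" "\<And>s. a \<le> s \<Longrightarrow> s < t \<Longrightarrow> \<xi> s = y"
    by (rule left_const[OF t]) blast
  have at: "A t = A a + q y * ennreal (t - a)" using a by (intro A_const) auto
  have "A a + q y * ennreal (t - a) \<le> c"
  proof (rule LIMSEQ_le_const2)
    have "(\<lambda>n. t - (t - a) * inverse (real (Suc n)) - a) \<longlonglongrightarrow> t - (t - a) * 0 - a"
      by (intro tendsto_intros LIMSEQ_inverse_real_of_nat)
    then have lim: "(\<lambda>n. ennreal (t - (t - a) * inverse (real (Suc n)) - a)) \<longlonglongrightarrow> ennreal (t - a)"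
      by (intro tendsto_ennrealI) simp
    show "(\<lambda>n. A a + q y * ennreal (t - (t - a) * inverse (real (Suc n)) - a)) \<longlonglongrightarrow>
      A a + q y * ennreal (t - a)"
      by (intro tendsto_add tendsto_const tendsto_mult_ennreal lim) (use a in auto)
    show "\<exists>N. \<forall>n\<ge>N. A a + q y * ennreal (t - (t - a) * inverse (real (Suc n)) - a) \<le> c"
    proof (intro exI[of _ 0] allI impI)
      fix n
      define s where "s = t - (t - a) * inverse (real (Suc n))"
      have "inverse (real (Suc n)) \<le> 1" by (simp add: inverse_eq_divide)
      then have "(t - a) * inverse (real (Suc n)) \<le> t - a" using a by (intro mult_left_le) auto
      moreover have "0 < (t - a) * inverse (real (Suc n))" using a by (intro mult_pos_pos) auto
      ultimately have s: "a \<le> s" "s < t" by (simp_all add: s_def)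
      have "A s = A a + q y * ennreal (s - a)" using a s by (intro A_const) auto
      then show "A a + q y * ennreal (t - (t - a) * inverse (real (Suc n)) - a) \<le> c"
        using c[of s] s a(1) by (simp add: s_def)
    qed
  qed
  then show ?thesis by (simp add: at)
qed

text \<open>The strict inequalities survive a small error in the accumulated rate. For such
  \<open>u\<close> the killing position, both in continuous time and on fine grids, is the constant
  state \<open>\<xi> a\<close>, whatever the exact killing times.\<close>

definition good_level :: "real \<Rightarrow> bool" where
  "good_level u \<longleftrightarrow> (\<exists>a b. 0 \<le> a \<and> a < b \<and> (\<forall>s. a \<le> s \<and> s \<le> b \<longrightarrow> \<xi> s = \<xi> a) \<and>
     A a < ennreal u \<and> ennreal u < A b)"

text \<open>A bad level is the accumulated rate at a jump time, and each jump time is the left end of the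
  constancy interval of some rational time.\<close>

lemma countable_bad_levels:
  "countable {u. u > 0 \<and> (\<exists>t\<ge>0. ennreal u < A t) \<and> \<not> good_level u}"
proof -
  define F where "F r = Inf {s. 0 \<le> s \<and> (\<forall>s'. s \<le> s' \<and> s' \<le> r \<longrightarrow> \<xi> s' = \<xi> r)}" for r
  have "{u. u > 0 \<and> (\<exists>t\<ge>0. ennreal u < A t) \<and> \<not> good_level u} \<subseteq> (\<lambda>r. enn2real (A (F r))) ` \<rat>"
  proof safe
    fix u t :: real
    assume u: "u > 0" and t: "0 \<le> t" "ennreal u < A t" and bad: "\<not> good_level u"
    define T where "T = {s. 0 \<le> s \<and> A s < ennreal u}"
    have T0: "0 \<in> T" using u A_0 by (simp add: T_def ennreal_zero_less_top)
    have Tt: "s \<le> t" if "s \<in> T" for s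
      using that t A_mono[of t s] by (auto simp: T_def) (meson leD le_cases order_less_trans order_le_less_trans)
    then have bdd: "bdd_above T" by (auto simp: bdd_above_def)
    \<comment> \<open>The crossing time of level \<open>u\<close>. Left continuity gives
      \<open>A \<tau> \<le> ennreal u\<close>; badness of \<open>u\<close> will force equality and a
      jump at \<open>\<tau>\<close>.\<close>
    define \<tau> where "\<tau> = Sup T"
    have \<tau>0: "0 \<le> \<tau>" unfolding \<tau>_def by (rule cSup_upper[OF T0 bdd])
    have below: "A s < ennreal u" if s: "0 \<le> s" "s < \<tau>" for s
    proof -
      obtain s' where "s' \<in> T" "s < s'" using s(2) less_cSupD[of T s] T0 unfolding \<tau>_def by blast
      then show ?thesis using A_mono[of s s'] by (auto simp: T_def)
    qed
    have above: "ennreal u \<le> A s" if "\<tau> < s" for s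
    proof (rule ccontr)
      assume "\<not> ennreal u \<le> A s"
      then have "s \<in> T" using that \<tau>0 by (simp add: T_def)
      then have "s \<le> \<tau>" unfolding \<tau>_def by (rule cSup_upper[OF _ bdd])
      then show False using that by simp
    qed
    have A\<tau>: "A \<tau> \<le> ennreal u"
      using A_left_le[of \<tau> "ennreal u"] below \<tau>0 A_0 by (cases "\<tau> = 0") (auto simp: less_imp_le)
    obtain b where b: "b > \<tau>" "\<And>s. \<tau> \<le> s \<Longrightarrow> s < b \<Longrightarrow> \<xi> s = \<xi> \<tau>"
      by (rule right_const[OF \<tau>0]) blast
    define c where "c = (\<tau> + b) / 2"
    have c: "\<tau> < c" "c < b" using b by (auto simp: c_def)
    have Ac: "A c = A s + q (\<xi> \<tau>) * ennreal (c - s)" if "\<tau> \<le> s" "s \<le> c" for s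
      by (intro A_const b(2)) (use that c \<tau>0 in auto)
    have const: "\<xi> s = \<xi> \<tau>" if "\<tau> \<le> s" "s \<le> c" for s
      by (rule b(2)) (use that c in auto)
    \<comment> \<open>The intermediate time \<open>d\<close> is needed since
      \<open>ennreal u \<le> A s\<close> is known only for \<open>s > \<tau>\<close>; the positive
      rate between \<open>d\<close> and \<open>c\<close> then makes the inequality strict.\<close>
    have exceeds: "ennreal u < A c" if pos: "q (\<xi> \<tau>) > 0"
    proof -
      define d where "d = (\<tau> + c) / 2"
      have d: "\<tau> < d" "d < c" using c by (auto simp: d_def)
      have "0 < q (\<xi> \<tau>) * ennreal (c - d)"
        using pos d by (simp add: ennreal_zero_less_mult_iff)
      then have "ennreal u < ennreal u + q (\<xi> \<tau>) * ennreal (c - d)"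
        using ennreal_add_left_cancel_less[of "ennreal u" 0] by simp
      also have "\<dots> \<le> A c" unfolding Ac[of d, OF less_imp_le[OF d(1)] less_imp_le[OF d(2)]]
        by (rule add_right_mono[OF above[OF d(1)]])
      finally show ?thesis .
    qed
    have eq: "A \<tau> = ennreal u"
    proof (rule ccontr)
      assume "A \<tau> \<noteq> ennreal u"
      then have lt: "A \<tau> < ennreal u" using A\<tau> by simp
      have "q (\<xi> \<tau>) > 0"
      proof (rule ccontr)
        assume "\<not> 0 < q (\<xi> \<tau>)"
        then have "A c = A \<tau>" using Ac[of \<tau>] c by simp
        then show False using above[OF c(1)] lt by simp
      qed
      then have "ennreal u < A c" by (rule exceeds)
      then have "good_level u"
        unfolding good_level_def
        by (intro exI[of _ \<tau>] exI[of _ c] conjI allI impI \<tau>0 c(1) lt) (rule const; simp)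
      then show False using bad by simp
    qed
    have "\<tau> > 0" using eq A_0 \<tau>0 u by (cases "\<tau> = 0") auto
    then obtain a y where a: "0 \<le> a" "a < \<tau>" "\<And>s. a \<le> s \<Longrightarrow> s < \<tau> \<Longrightarrow> \<xi> s = y"
      by (rule left_const) blast
    \<comment> \<open>Without a jump at \<open>\<tau>\<close> the interval of constancy would reach
      back to \<open>a\<close>, where \<open>A\<close> is below \<open>u\<close>, and
      \<open>a\<close>, \<open>c\<close> would witness a good level.\<close>
    have "y \<noteq> \<xi> \<tau>"
    proof
      assume y: "y = \<xi> \<tau>"
      have Aa: "A \<tau> = A a + q y * ennreal (\<tau> - a)" using a by (intro A_const) auto
      have lt: "A a < ennreal u" using below a by simp
      then have "q y > 0" using Aa eq by (cases "q y = 0") (auto simp: zero_less_iff_neq_zero)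
      then have uc: "ennreal u < A c" using y exceeds by simp
      have "\<xi> s = \<xi> a" if "a \<le> s" "s \<le> c" for s
        using a(3)[of s] a(3)[of a] const[of s] a(2) y that by (cases "s < \<tau>") auto
      then have eqa: "\<forall>s. a \<le> s \<and> s \<le> c \<longrightarrow> \<xi> s = \<xi> a" by blast
      have "a < c" using a(2) c(1) by simp
      have "good_level u"
        unfolding good_level_def
        by (intro exI[of _ a] exI[of _ c] conjI a(1) \<open>a < c\<close> eqa lt uc)
      then show False using bad by simp
    qed
    obtain r where r: "r \<in> \<rat>" "\<tau> < r" "r < c" using Rats_dense_in_real[OF c(1)] by blast
    have \<xi>r: "\<xi> r = \<xi> \<tau>" by (rule const) (use r in auto)
    have "F r = \<tau>"
      unfolding F_def
    proof (rule cInf_eq_minimum)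
      show "\<tau> \<in> {s. 0 \<le> s \<and> (\<forall>s'. s \<le> s' \<and> s' \<le> r \<longrightarrow> \<xi> s' = \<xi> r)}"
      proof (intro CollectI conjI allI impI \<tau>0)
        fix s' assume "\<tau> \<le> s' \<and> s' \<le> r"
        then show "\<xi> s' = \<xi> r" unfolding \<xi>r by (intro const) (use r in auto)
      qed
      fix s assume s: "s \<in> {s. 0 \<le> s \<and> (\<forall>s'. s \<le> s' \<and> s' \<le> r \<longrightarrow> \<xi> s' = \<xi> r)}"
      show "\<tau> \<le> s"
      proof (rule ccontr)
        assume "\<not> \<tau> \<le> s"
        then have m: "s \<le> max s a" "max s a \<le> r" "a \<le> max s a" "max s a < \<tau>"
          using a(2) r(2) by auto
        have "\<xi> (max s a) = \<xi> r" using s m(1,2) by blast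
        moreover have "\<xi> (max s a) = y" using a(3) m(3,4) by blast
        ultimately have "\<xi> r = y" by metis
        then show False using \<open>y \<noteq> \<xi> \<tau>\<close> \<xi>r by simp
      qed
    qed
    then have "enn2real (A (F r)) = u" using eq u by simp
    then show "u \<in> (\<lambda>r. enn2real (A (F r))) ` \<rat>" using r(1) by (intro image_eqI[of _ _ r]) auto
  qed
  then show ?thesis by (rule countable_subset) (simp add: countable_rat)
qed

subsection \<open>Convergence of Riemann sums\<close>

lemma eventually_ceiling_grid:
  assumes "0 \<le> s" and "s < a"
  shows "eventually (\<lambda>m. \<xi> (ceiling_grid m s) = \<xi> s \<and> ceiling_grid m s < a) sequentially"
proof -
  obtain b where b: "b > s" "\<And>s'. s \<le> s' \<Longrightarrow> s' < b \<Longrightarrow> \<xi> s' = \<xi> s"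
    by (rule right_const[OF assms(1)]) blast
  have "eventually (\<lambda>n. inverse (real (Suc n)) < min b a - s) sequentially"
    using LIMSEQ_inverse_real_of_nat by (rule order_tendstoD) (use b assms in auto)
  then show ?thesis
  proof eventually_elim
    case (elim m)
    then show ?case using ceiling_grid_ge[of s m] ceiling_grid_less[of m s] b(2)[of "ceiling_grid m s"] by auto
  qed
qed

lemma measurable_ceiling_grid [measurable]: "(\<lambda>s. q (\<xi> (ceiling_grid m s))) \<in> borel_measurable borel"
proof -
  have "(\<lambda>s. \<lceil>s * real (Suc m)\<rceil>) \<in> measurable borel (count_space UNIV)" by measurable
  then have "(\<lambda>s. (\<lambda>k. q (\<xi> (of_int k / real (Suc m)))) \<lceil>s * real (Suc m)\<rceil>) \<in> borel_measurable borel"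
    by (rule measurable_compose) simp
  then show ?thesis by (simp add: ceiling_grid_def)
qed

text \<open>This form lets convergence theorems for integrals act on the sum. The term at
  \<open>0\<close> stands apart because positive \<open>s\<close> are rounded up to positive grid
  times.\<close>

lemma grid_rate_Suc_eq:
  "grid_rate q \<xi> m (Suc n) = ennreal (1 / real (Suc m)) * q (\<xi> 0) +
     (\<integral>\<^sup>+ s. q (\<xi> (ceiling_grid m s)) * indicator {0<..real n / real (Suc m)} s \<partial>lborel)"
proof (induction n)
  case 0
  show ?case by (simp add: grid_rate_def)
next
  case (Suc n)
  let ?h = "1 / real (Suc m)" and ?g = "\<lambda>n. real n / real (Suc m)"
  have le: "?g n \<le> ?g (Suc n)" by (simp add: divide_right_mono)
  have diff: "?g (Suc n) - ?g n = ?h" by (simp add: field_simps)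
  have r: "ceiling_grid m s = ?g (Suc n)" if "?g n < s" "s \<le> ?g (Suc n)" for s
  proof -
    have "\<lceil>s * real (Suc m)\<rceil> = int (Suc n)"
      using that by (intro ceiling_unique) (simp_all add: field_simps)
    then show ?thesis by (simp only: ceiling_grid_def of_int_of_nat_eq)
  qed
  have "(\<integral>\<^sup>+ s. q (\<xi> (ceiling_grid m s)) * indicator {0<..?g (Suc n)} s \<partial>lborel) =
    (\<integral>\<^sup>+ s. q (\<xi> (ceiling_grid m s)) * indicator {0<..?g n} s +
      q (\<xi> (?g (Suc n))) * indicator {?g n<..?g (Suc n)} s \<partial>lborel)"
  proof (rule nn_integral_cong)
    fix s
    have "0 < s" if "?g n < s" using that by (rule le_less_trans[rotated]) simp
    then show "q (\<xi> (ceiling_grid m s)) * indicator {0<..?g (Suc n)} s = q (\<xi> (ceiling_grid m s)) * indicator {0<..?g n} s +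
      q (\<xi> (?g (Suc n))) * indicator {?g n<..?g (Suc n)} s"
      using le r[of s] by (cases "s \<le> ?g n"; cases "s \<le> ?g (Suc n)"; cases "0 < s") (auto simp del: of_nat_Suc)
  qed
  also have "\<dots> = (\<integral>\<^sup>+ s. q (\<xi> (ceiling_grid m s)) * indicator {0<..?g n} s \<partial>lborel) +
      q (\<xi> (?g (Suc n))) * emeasure lborel {?g n<..?g (Suc n)}"
    by (subst nn_integral_add) (auto simp: nn_integral_cmult_indicator simp del: of_nat_Suc)
  also have "emeasure lborel {?g n<..?g (Suc n)} = ennreal ?h"
    using le diff by (simp del: of_nat_Suc)
  finally show ?case using Suc
    by (simp add: grid_rate_def add.assoc mult.commute del: of_nat_Suc)
qed

lemma A_infinite_after:
  assumes "0 \<le> s" "s < t" "q (\<xi> s) = \<infinity>"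
  shows "A t = \<infinity>"
proof -
  obtain b where b: "b > s" "\<And>s'. s \<le> s' \<Longrightarrow> s' < b \<Longrightarrow> \<xi> s' = \<xi> s"
    by (rule right_const[OF assms(1)]) blast
  define c where "c = min t ((s + b) / 2)"
  have c: "s < c" "c \<le> t" "c < b" using assms(2) b(1) by (auto simp: c_def min_def)
  have "A c = A s + q (\<xi> s) * ennreal (c - s)" by (intro A_const b(2)) (use assms(1) c(1,3) in auto)
  moreover have "q (\<xi> s) * ennreal (c - s) = \<infinity>"
    unfolding assms(3) using c(1) by (simp add: ennreal_top_mult)
  ultimately have "A c = \<infinity>" by simp
  then show ?thesis using A_mono[OF c(2)] by (simp add: top_unique)
qed

text \<open>Dominated convergence: as \<open>A a\<close> is finite, the path avoids infinite rates
  before \<open>a\<close>, and the largest finite rate dominates. The state at \<open>a\<close> may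
  have infinite rate, hence the strict bound on the grid times.\<close>

lemma eventually_grid_rate_less:
  assumes a: "0 \<le> a" and less: "A a < ennreal u"
  shows "eventually (\<lambda>m. \<forall>n. real n / real (Suc m) < a \<longrightarrow> grid_rate q \<xi> m (Suc n) < ennreal u) sequentially"
proof (cases "a = 0")
  case True
  then show ?thesis by (simp add: divide_less_0_iff)
next
  case False
  then have a: "0 < a" using a by simp
  have fin: "q (\<xi> s) < \<infinity>" if "0 \<le> s" "s < a" for s
    using A_infinite_after[OF that] less by (auto simp: top.not_eq_extremum[symmetric])
  define C where "C = Max (insert 0 (q ` {y. q y < \<infinity>}))"
  have C: "C < \<infinity>" unfolding C_def by (subst Max_less_iff) auto
  have le_C: "q y \<le> C" if "q y < \<infinity>" for y unfolding C_def using that by (intro Max_ge) auto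
  \<comment> \<open>One integrand serves all \<open>n\<close> with grid time below \<open>a\<close>,
    which makes the bound uniform in \<open>n\<close>.\<close>
  define G where "G m s = q (\<xi> (ceiling_grid m s)) * indicator {s. 0 < s \<and> ceiling_grid m s < a} s" for m s
  have ru [measurable]: "ceiling_grid m \<in> borel_measurable borel" for m
    unfolding ceiling_grid_def by measurable
  have lim: "(\<lambda>m. \<integral>\<^sup>+ s. G m s \<partial>lborel) \<longlonglongrightarrow> (\<integral>\<^sup>+ s. q (\<xi> (max s 0)) * indicator {0<..<a} s \<partial>lborel)"
  proof (rule nn_integral_dominated_convergence[where w = "\<lambda>s. C * indicator {0<..<a} s"])
    show "G m \<in> borel_measurable lborel" for m unfolding G_def by measurable
    show "AE s in lborel. G m s \<le> C * indicator {0<..<a} s" for m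
    proof (rule AE_I2)
      fix s
      show "G m s \<le> C * indicator {0<..<a} s"
        using ceiling_grid_ge[of s m] le_C[OF fin[of "ceiling_grid m s"]]
        by (auto simp: G_def indicator_def)
    qed
    show "(\<integral>\<^sup>+ s. C * indicator {0<..<a} s \<partial>lborel) < \<infinity>"
      using a C by (simp add: nn_integral_cmult_indicator ennreal_mult_less_top)
    show "AE s in lborel. (\<lambda>m. G m s) \<longlonglongrightarrow> q (\<xi> (max s 0)) * indicator {0<..<a} s"
    proof (rule AE_I2)
      fix s
      show "(\<lambda>m. G m s) \<longlonglongrightarrow> q (\<xi> (max s 0)) * indicator {0<..<a} s"
      proof (cases "0 < s \<and> s < a")
        case True
        then have "eventually (\<lambda>m. \<xi> (ceiling_grid m s) = \<xi> s \<and> ceiling_grid m s < a) sequentially"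
          by (intro eventually_ceiling_grid) auto
        then have "eventually (\<lambda>m. G m s = q (\<xi> (max s 0)) * indicator {0<..<a} s) sequentially"
          by eventually_elim (use True in \<open>simp add: G_def\<close>)
        then show ?thesis by (rule tendsto_eventually)
      next
        case False
        then have "G m s = 0" for m using ceiling_grid_ge[of s m] by (auto simp: G_def indicator_def)
        then show ?thesis using False by auto
      qed
    qed
  qed measurable
  have "(\<integral>\<^sup>+ s. q (\<xi> (max s 0)) * indicator {0<..<a} s \<partial>lborel) \<le> A a"
    unfolding A_eq by (intro nn_integral_mono mult_left_mono) (auto simp: indicator_def)
  then have lt: "(\<integral>\<^sup>+ s. q (\<xi> (max s 0)) * indicator {0<..<a} s \<partial>lborel) < ennreal u" using less by simp
  have "(\<lambda>m. ennreal (1 / real (Suc m)) * q (\<xi> 0)) \<longlonglongrightarrow> ennreal 0 * q (\<xi> 0)"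
  proof (rule tendsto_mult_ennreal)
    show "(\<lambda>m. ennreal (1 / real (Suc m))) \<longlonglongrightarrow> ennreal 0"
      using LIMSEQ_inverse_real_of_nat by (intro tendsto_ennrealI) (simp add: inverse_eq_divide)
  qed (use fin[of 0] a in auto)
  then have "(\<lambda>m. ennreal (1 / real (Suc m)) * q (\<xi> 0) + (\<integral>\<^sup>+ s. G m s \<partial>lborel)) \<longlonglongrightarrow>
    ennreal 0 * q (\<xi> 0) + (\<integral>\<^sup>+ s. q (\<xi> (max s 0)) * indicator {0<..<a} s \<partial>lborel)"
    by (intro tendsto_add lim)
  then have "eventually (\<lambda>m. ennreal (1 / real (Suc m)) * q (\<xi> 0) + (\<integral>\<^sup>+ s. G m s \<partial>lborel) < ennreal u) sequentially"
    by (rule order_tendstoD) (use lt in simp)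
  then show ?thesis
  proof eventually_elim
    case (elim m)
    show ?case
    proof (intro allI impI)
      fix n assume n: "real n / real (Suc m) < a"
      have "(\<integral>\<^sup>+ s. q (\<xi> (ceiling_grid m s)) * indicator {0<..real n / real (Suc m)} s \<partial>lborel) \<le> (\<integral>\<^sup>+ s. G m s \<partial>lborel)"
        unfolding G_def
      proof (intro nn_integral_mono mult_left_mono)
        fix s
        have "ceiling_grid m s < a" if "s \<le> real n / real (Suc m)"
        proof -
          have "\<lceil>s * real (Suc m)\<rceil> \<le> int n" using that by (simp add: ceiling_le_iff field_simps)
          then have "of_int \<lceil>s * real (Suc m)\<rceil> \<le> real n" by linarith
          then have "ceiling_grid m s \<le> real n / real (Suc m)" unfolding ceiling_grid_def by (rule divide_right_mono) simp
          then show ?thesis using n by simp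
        qed
        then show "indicator {0<..real n / real (Suc m)} s \<le> (indicator {s. 0 < s \<and> ceiling_grid m s < a} s :: ennreal)"
          by (auto simp: indicator_def)
      qed simp
      then have "grid_rate q \<xi> m (Suc n) \<le> ennreal (1 / real (Suc m)) * q (\<xi> 0) + (\<integral>\<^sup>+ s. G m s \<partial>lborel)"
        unfolding grid_rate_Suc_eq by (rule add_left_mono)
      then show "grid_rate q \<xi> m (Suc n) < ennreal u" using elim by simp
    qed
  qed
qed

lemma eventually_grid_rate_greater:
  assumes b: "0 \<le> b" and less: "ennreal u < A b"
  shows "eventually (\<lambda>m. \<exists>n. real n / real (Suc m) \<le> b \<and> ennreal u < grid_rate q \<xi> m (Suc n)) sequentially"
proof -
  define G where "G m s = q (\<xi> (ceiling_grid m s)) * indicator {s. 0 < s \<and> ceiling_grid m s \<le> b} s" for m s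
  have ru [measurable]: "ceiling_grid m \<in> borel_measurable borel" for m
    unfolding ceiling_grid_def by measurable
  have G [measurable]: "G m \<in> borel_measurable borel" for m unfolding G_def by measurable
  have "A b \<le> (\<integral>\<^sup>+ s. liminf (\<lambda>m. G m s) \<partial>lborel)"
    unfolding A_eq
  proof (rule nn_integral_mono_AE)
    show "AE s in lborel. q (\<xi> (max s 0)) * indicator {0..b} s \<le> liminf (\<lambda>m. G m s)"
      using AE_lborel_singleton[of 0] AE_lborel_singleton[of b]
    proof eventually_elim
      case (elim s)
      show ?case
      proof (cases "0 < s \<and> s < b")
        case True
        then have "eventually (\<lambda>m. \<xi> (ceiling_grid m s) = \<xi> s \<and> ceiling_grid m s < b) sequentially"
          by (intro eventually_ceiling_grid) auto
        then have "eventually (\<lambda>m. G m s = q (\<xi> s)) sequentially"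
          by eventually_elim (use True in \<open>simp add: G_def\<close>)
        then have "(\<lambda>m. G m s) \<longlonglongrightarrow> q (\<xi> s)" by (rule tendsto_eventually)
        then have "liminf (\<lambda>m. G m s) = q (\<xi> s)" by (intro lim_imp_Liminf) auto
        then show ?thesis using True by simp
      next
        case False
        then show ?thesis using elim by (auto simp: indicator_def)
      qed
    qed
  qed
  also have "\<dots> \<le> liminf (\<lambda>m. \<integral>\<^sup>+ s. G m s \<partial>lborel)" by (rule nn_integral_liminf) simp
  finally have "ennreal u < liminf (\<lambda>m. \<integral>\<^sup>+ s. G m s \<partial>lborel)" using less by simp
  then have "eventually (\<lambda>m. ennreal u < (\<integral>\<^sup>+ s. G m s \<partial>lborel)) sequentially" by (rule less_LiminfD)
  then show ?thesis
  proof eventually_elim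
    case (elim m)
    \<comment> \<open>The index of the last grid time not exceeding \<open>b\<close>.\<close>
    define n where "n = nat \<lfloor>b * real (Suc m)\<rfloor>"
    have n: "real n = of_int \<lfloor>b * real (Suc m)\<rfloor>" using b by (simp add: n_def)
    have "real n \<le> b * real (Suc m)" unfolding n by linarith
    then have nb: "real n / real (Suc m) \<le> b" by (simp add: field_simps)
    have "(\<integral>\<^sup>+ s. G m s \<partial>lborel) \<le> (\<integral>\<^sup>+ s. q (\<xi> (ceiling_grid m s)) * indicator {0<..real n / real (Suc m)} s \<partial>lborel)"
      unfolding G_def
    proof (intro nn_integral_mono mult_left_mono)
      fix s
      have "s \<le> real n / real (Suc m)" if "ceiling_grid m s \<le> b"
      proof -
        have "of_int \<lceil>s * real (Suc m)\<rceil> \<le> b * real (Suc m)" using that by (simp add: ceiling_grid_def field_simps)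
        then have "\<lceil>s * real (Suc m)\<rceil> \<le> \<lfloor>b * real (Suc m)\<rfloor>" by (simp add: le_floor_iff)
        then have "s * real (Suc m) \<le> real n" unfolding n by linarith
        then show ?thesis by (simp add: field_simps)
      qed
      then show "indicator {s. 0 < s \<and> ceiling_grid m s \<le> b} s \<le> (indicator {0<..real n / real (Suc m)} s :: ennreal)"
        by (auto simp: indicator_def)
    qed simp
    also have "\<dots> \<le> grid_rate q \<xi> m (Suc n)" unfolding grid_rate_Suc_eq by simp
    finally show ?case using nb elim by (intro exI[of _ n]) auto
  qed
qed

text \<open>Both crossings of level \<open>u\<close> are caught between \<open>a\<close> and
  \<open>b\<close>: before \<open>a\<close> neither the accumulated rate nor the grid rate has
  reached \<open>u\<close>, by \<open>b\<close> both have, and the path is constant in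
  between.\<close>

lemma eventually_killed_at_iff:
  assumes u: "0 < u" and good: "good_level u"
  shows "eventually (\<lambda>m. \<forall>y. (\<exists>n. grid_killed_at q \<xi> u m n y) \<longleftrightarrow> killed_at q \<xi> u y) sequentially"
proof -
  obtain a b where ab: "0 \<le> a" "a < b" and const: "\<And>s. a \<le> s \<Longrightarrow> s \<le> b \<Longrightarrow> \<xi> s = \<xi> a"
    and Aa: "A a < ennreal u" and Ab: "ennreal u < A b"
    using good unfolding good_level_def by blast
  let ?T = "{t. 0 \<le> t \<and> (\<xi> t \<in> infinite_killing q \<or> ennreal u \<le> A t)}"
  define \<tau> where "\<tau> = killing_time (\<lambda>t _. \<xi> t) q () u"
  have \<tau>: "\<tau> = Inf (ereal ` ?T)" by (simp add: \<tau>_def killing_time_def accumulated_rate_def)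
  have "a \<le> t" if "t \<in> ?T" for t
  proof (rule ccontr)
    assume "\<not> a \<le> t"
    then have t: "0 \<le> t" "t < a" using that by auto
    then have "\<not> ennreal u \<le> A t" using Aa A_mono[of t a] by (auto simp: not_le)
    then have "q (\<xi> t) = \<infinity>" using that by (simp add: infinite_killing_def)
    then show False using A_infinite_after[OF t] Aa by simp
  qed
  then have "ereal a \<le> \<tau>" unfolding \<tau> by (intro Inf_greatest) auto
  moreover have "\<tau> \<le> ereal b" unfolding \<tau> by (rule Inf_lower) (use ab Ab in auto)
  ultimately obtain r where r: "\<tau> = ereal r" "a \<le> r" "r \<le> b" by (cases \<tau>) auto
  have killed: "killed_at q \<xi> u y \<longleftrightarrow> y = \<xi> a" for y
    using const[of r] r unfolding killed_at_def \<tau>_def[symmetric] by auto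
  show ?thesis
    using eventually_grid_rate_less[OF ab(1) Aa] eventually_grid_rate_greater[OF less_imp_le[OF le_less_trans[OF ab]] Ab]
  proof eventually_elim
    case (elim m)
    obtain n0 where n0: "real n0 / real (Suc m) \<le> b" "ennreal u < grid_rate q \<xi> m (Suc n0)" using elim by blast
    have between: "\<xi> (real n / real (Suc m)) = \<xi> a"
      if n: "grid_rate q \<xi> m n < ennreal u" "ennreal u \<le> grid_rate q \<xi> m (Suc n)" for n
    proof (rule const)
      show "a \<le> real n / real (Suc m)" using elim(1) n(2) by (meson not_le)
      have "n \<le> n0" using n(1) n0(2) grid_rate_mono[of "Suc n0" n q \<xi> m] by (meson not_less_eq_eq not_le order_less_trans order_less_le_trans less_irrefl)
      then have "real n / real (Suc m) \<le> real n0 / real (Suc m)" by (intro divide_right_mono) auto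
      then show "real n / real (Suc m) \<le> b" using n0(1) by simp
    qed
    have "\<exists>n. grid_rate q \<xi> m n < ennreal u \<and> ennreal u \<le> grid_rate q \<xi> m (Suc n)"
    proof -
      define n where "n = (LEAST n. ennreal u \<le> grid_rate q \<xi> m n)"
      have le: "ennreal u \<le> grid_rate q \<xi> m n" unfolding n_def by (rule LeastI[of _ "Suc n0"]) (use n0 in simp)
      then obtain k where k: "n = Suc k" using u by (cases n) (auto simp: grid_rate_def)
      then have "\<not> ennreal u \<le> grid_rate q \<xi> m k" unfolding n_def by (intro not_less_Least) (simp add: n_def[symmetric])
      then show ?thesis using le k by (auto simp: not_le)
    qed
    then obtain n1 where n1: "grid_rate q \<xi> m n1 < ennreal u" "ennreal u \<le> grid_rate q \<xi> m (Suc n1)" by blast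
    show ?case
    proof
      fix y
      show "(\<exists>n. grid_killed_at q \<xi> u m n y) \<longleftrightarrow> killed_at q \<xi> u y"
        unfolding killed grid_killed_at_def using between n1 by metis
    qed
  qed
qed

end

section \<open>The killed process on a grid\<close>

lemma space_exponential_clock [simp]: "space exponential_clock = UNIV"
  and sets_exponential_clock [simp, measurable_cong]: "sets exponential_clock = sets borel"
  by (simp_all add: exponential_clock_def)

lemma prob_space_exponential_clock: "prob_space exponential_clock"
  unfolding exponential_clock_def by (rule prob_space_exponential_density) simp

lemma AE_exponential_clock:
  assumes "countable C"
  shows "AE u in exponential_clock. 0 < u \<and> u \<notin> C"
proof -
  have "AE u in lborel. u \<notin> insert 0 C"
    using assms by (intro AE_not_in countable_imp_null_set_lborel) auto
  then have "AE u in lborel. 0 < ennreal (exponential_density 1 u) \<longrightarrow> 0 < u \<and> u \<notin> C"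
    by eventually_elim (auto simp: exponential_density_def not_less)
  then show ?thesis unfolding exponential_clock_def by (subst AE_density) auto
qed

lemma emeasure_exponential_clock_greater:
  "emeasure exponential_clock {u. b < ennreal u} = (if b = \<infinity> then 0 else ennreal (exp (- enn2real b)))"
proof (cases "b = \<infinity>")
  case False
  interpret prob_space exponential_clock by (rule prob_space_exponential_clock)
  define r where "r = enn2real b"
  have r: "0 \<le> r" "b = ennreal r" using False by (simp_all add: r_def top.not_eq_extremum)
  have eq: "{u. b < ennreal u} = UNIV - {..r}" unfolding r(2) using r(1)
    by (auto simp: ennreal_less_iff not_le)
  have "emeasure exponential_clock {..r} = ennreal (1 - exp (- r))"
    unfolding exponential_clock_def using r(1) by (simp add: emeasure_erlang_density erlang_CDF_0)
  then have "prob {..r} = 1 - exp (- r)" using r(1) by (simp add: measure_def)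
  then have "prob {u. b < ennreal u} = exp (- r)"
    unfolding eq using prob_compl[of "{..r}"] by simp
  then show ?thesis using False by (simp add: emeasure_eq_measure r_def)
qed simp

definition survival :: "('a \<Rightarrow> ennreal) \<Rightarrow> nat \<Rightarrow> 'a \<Rightarrow> real" where
  "survival q m y = (if q y = \<infinity> then 0 else exp (- enn2real (q y) / real (Suc m)))"

lemma survival_bounds: "0 \<le> survival q m y" "survival q m y \<le> 1"
  by (simp_all add: survival_def)

text \<open>For a given path the exponential clock turns the sum of rates into a product of one-step
  survival factors; this is what makes the killed observations a Markov chain.\<close>

lemma emeasure_grid_survival:
  "emeasure exponential_clock {u. grid_rate q \<xi> m n < ennreal u} =
     (\<Prod>j<n. ennreal (survival q m (\<xi> (real j / real (Suc m)))))"
proof (cases "\<exists>j<n. q (\<xi> (real j / real (Suc m))) = \<infinity>")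
  case True
  then obtain j where j: "j < n" "q (\<xi> (real j / real (Suc m))) = \<infinity>" by blast
  have "ennreal (1 / real (Suc m)) * q (\<xi> (real j / real (Suc m))) = \<infinity>"
    unfolding j(2) by (simp add: ennreal_mult_top)
  moreover have "ennreal (1 / real (Suc m)) * q (\<xi> (real j / real (Suc m))) \<le> grid_rate q \<xi> m n"
    unfolding grid_rate_def using j(1) by (intro member_le_sum) auto
  ultimately have "grid_rate q \<xi> m n = \<infinity>" by (simp add: top_unique)
  moreover have "(\<Prod>j<n. ennreal (survival q m (\<xi> (real j / real (Suc m))))) = 0"
    using j by (auto simp: survival_def intro!: bexI[of _ j])
  ultimately show ?thesis by (simp add: emeasure_exponential_clock_greater)
next
  case False
  let ?r = "\<lambda>j. enn2real (q (\<xi> (real j / real (Suc m)))) / real (Suc m)"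
  have "ennreal (1 / real (Suc m)) * q (\<xi> (real j / real (Suc m))) = ennreal (?r j)" if "j < n" for j
  proof -
    have "q (\<xi> (real j / real (Suc m))) = ennreal (enn2real (q (\<xi> (real j / real (Suc m)))))"
      using False that by (simp add: top.not_eq_extremum)
    then show ?thesis by (metis ennreal_mult' enn2real_nonneg mult.commute times_divide_eq_right mult.right_neutral)
  qed
  then have gr: "grid_rate q \<xi> m n = ennreal (\<Sum>j<n. ?r j)"
    unfolding grid_rate_def by (subst sum_ennreal[symmetric]) auto
  have "(\<Sum>j<n. ?r j) \<ge> 0" by (intro sum_nonneg) auto
  moreover have "exp (- (\<Sum>j<n. ?r j)) = (\<Prod>j<n. survival q m (\<xi> (real j / real (Suc m))))"
    unfolding sum_negf[symmetric] exp_sum[OF finite_lessThan]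
    by (rule prod.cong) (use False in \<open>auto simp: survival_def\<close>)
  ultimately show ?thesis
    by (simp add: emeasure_exponential_clock_greater gr prod_ennreal survival_bounds)
qed

section \<open>The chain of grid observations\<close>

locale killed_markov_process = markov_process w M P X
  for w :: "'a::finite \<Rightarrow> 'a \<Rightarrow> real" and M :: "'w measure" and P and X +
  fixes q :: "'a \<Rightarrow> ennreal"
begin

lemma space_P [simp]: "space (P x) = space M"
  by (rule sets_eq_imp_space_eq[OF sets_P])

declare sets_P [simp, measurable_cong]

lemma past_events_sets: "0 \<le> t \<Longrightarrow> B \<in> past_events M X t \<Longrightarrow> B \<in> sets M"
proof -
  assume t: "0 \<le> t" and B: "B \<in> past_events M X t"
  have "{X r -` {y} \<inter> space M |r y. 0 \<le> r \<and> r \<le> t} \<subseteq> sets M"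
    using measurable_X by (auto intro: measurable_sets)
  then show "B \<in> sets M"
    using B sets.sigma_sets_subset unfolding past_events_def by blast
qed

lemma past_events_step:
  assumes "0 \<le> t" "t \<le> t'" "B \<in> past_events M X t"
  shows "{\<omega> \<in> B. X t \<omega> = y} \<in> past_events M X t'"
proof -
  let ?G = "{X r -` {y} \<inter> space M |r y. 0 \<le> r \<and> r \<le> t'}"
  interpret sigma_algebra "space M" "sigma_sets (space M) ?G"
    by (rule sigma_algebra_sigma_sets) auto
  have "past_events M X t \<subseteq> past_events M X t'"
    unfolding past_events_def by (rule sigma_sets_mono') (use assms(2) order_trans in blast)
  then have "B \<in> past_events M X t'" using assms(3) by blast
  moreover have "X t -` {y} \<inter> space M \<in> past_events M X t'"
    unfolding past_events_def by (intro sigma_sets.Basic CollectI exI[of _ t] exI[of _ y] conjI refl assms(1,2))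
  ultimately have "B \<inter> (X t -` {y} \<inter> space M) \<in> past_events M X t'"
    unfolding past_events_def by (rule local.Int)
  moreover have "B \<inter> (X t -` {y} \<inter> space M) = {\<omega> \<in> B. X t \<omega> = y}"
    using sets.sets_into_space[OF past_events_sets[OF assms(1,3)]] by blast
  ultimately show ?thesis by (simp only:)
qed

lemma measurable_X_event [measurable]: "0 \<le> t \<Longrightarrow> {\<omega> \<in> space M. X t \<omega> = y} \<in> sets M"
proof -
  assume "0 \<le> t"
  then have "X t -` {y} \<inter> space M \<in> sets M" using measurable_X by (intro measurable_sets) auto
  then show ?thesis by (simp add: vimage_def Int_def conj_commute)
qed

lemma measurable_fun_X: "0 \<le> t \<Longrightarrow> (\<lambda>\<omega>. f (X t \<omega>)) \<in> measurable M N'" if "\<And>y. f y \<in> space N'"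
  by (rule measurable_compose[OF measurable_X]) (use that in auto)

definition transition :: "real \<Rightarrow> 'a \<Rightarrow> 'a \<Rightarrow> real" where
  "transition h x z = measure (P x) {\<omega> \<in> space M. X h \<omega> = z}"

text \<open>With \<open>g\<close> the survival factor this is the operator \<open>e_h P_h\<close>;
  extended nonnegative values spare integrability conditions.\<close>

definition ennreal_step :: "real \<Rightarrow> ('a \<Rightarrow> ennreal) \<Rightarrow> ('a \<Rightarrow> ennreal) \<Rightarrow> 'a \<Rightarrow> ennreal" where
  "ennreal_step h g f x = g x * (\<Sum>z\<in>UNIV. ennreal (transition h x z) * f z)"

text \<open>An arbitrary time \<open>t\<close> and past event \<open>B\<close> let the induction
  close: \<open>{\<omega> \<in> B. X t \<omega> = y}\<close> is a past event at time
  \<open>t + h\<close>, and the Markov property at the fixed time \<open>t\<close> supplies the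
  transition factor.\<close>

lemma nn_integral_chain_past:
  assumes h: "0 \<le> h" and t: "0 \<le> t" and B: "B \<in> past_events M X t"
  shows "(\<integral>\<^sup>+ \<omega>. indicator {\<omega> \<in> B. X t \<omega> = y} \<omega> *
      ((\<Prod>j<n. g (X (t + real j * h) \<omega>)) * f (X (t + real n * h) \<omega>)) \<partial>P x) =
    emeasure (P x) {\<omega> \<in> B. X t \<omega> = y} * (ennreal_step h g ^^ n) f y"
  using t B
proof (induction n arbitrary: t B y)
  case 0
  have s: "{\<omega> \<in> B. X t \<omega> = y} \<in> sets M"
    using past_events_sets[OF 0(1)] past_events_step[OF 0(1) order_refl 0(2)] by blast
  have "(\<integral>\<^sup>+ \<omega>. indicator {\<omega> \<in> B. X t \<omega> = y} \<omega> *
      ((\<Prod>j<0. g (X (t + real j * h) \<omega>)) * f (X (t + real 0 * h) \<omega>)) \<partial>P x) =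
    (\<integral>\<^sup>+ \<omega>. f y * indicator {\<omega> \<in> B. X t \<omega> = y} \<omega> \<partial>P x)"
    by (intro nn_integral_cong) (auto simp: indicator_def)
  also have "\<dots> = f y * emeasure (P x) {\<omega> \<in> B. X t \<omega> = y}"
    by (rule nn_integral_cmult_indicator) (use s in simp)
  finally show ?case by (simp add: mult.commute)
next
  case (Suc n)
  let ?B = "{\<omega> \<in> B. X t \<omega> = y}"
  let ?F = "\<lambda>\<omega>. (\<Prod>j<n. g (X (t + h + real j * h) \<omega>)) * f (X (t + h + real n * h) \<omega>)"
  interpret prob_space "P x" by (rule prob_space_P)
  have th: "0 \<le> t + h" using Suc.prems h by simp
  have B': "?B \<in> past_events M X (t + h)" using past_events_step Suc.prems h by simp
  have s: "{\<omega> \<in> ?B. X (t + h) \<omega> = z} \<in> sets M" for z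
    using past_events_sets[OF th] past_events_step[OF th order_refl B'] by blast
  have "?F \<in> borel_measurable M"
    using h th by (intro borel_measurable_times_ennreal borel_measurable_prod_ennreal measurable_fun_X) auto
  then have F: "?F \<in> borel_measurable (P x)" by (simp cong: measurable_cong_sets)
  have "(\<integral>\<^sup>+ \<omega>. indicator ?B \<omega> *
      ((\<Prod>j<Suc n. g (X (t + real j * h) \<omega>)) * f (X (t + real (Suc n) * h) \<omega>)) \<partial>P x) =
    (\<integral>\<^sup>+ \<omega>. (\<Sum>z\<in>UNIV. g y * (indicator {\<omega> \<in> ?B. X (t + h) \<omega> = z} \<omega> * ?F \<omega>)) \<partial>P x)"
  proof (rule nn_integral_cong)
    fix \<omega>
    have "(\<Prod>j<Suc n. g (X (t + real j * h) \<omega>)) * f (X (t + real (Suc n) * h) \<omega>) = g (X t \<omega>) * ?F \<omega>"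
      unfolding prod.lessThan_Suc_shift by (simp add: algebra_simps)
    moreover have "(\<Sum>z\<in>UNIV. g y * (indicator {\<omega> \<in> ?B. X (t + h) \<omega> = z} \<omega> * ?F \<omega>)) =
      (\<Sum>z\<in>UNIV. if X (t + h) \<omega> = z then g y * (indicator ?B \<omega> * ?F \<omega>) else 0)"
      by (intro sum.cong) (auto simp: indicator_def)
    ultimately show "indicator ?B \<omega> *
        ((\<Prod>j<Suc n. g (X (t + real j * h) \<omega>)) * f (X (t + real (Suc n) * h) \<omega>)) =
      (\<Sum>z\<in>UNIV. g y * (indicator {\<omega> \<in> ?B. X (t + h) \<omega> = z} \<omega> * ?F \<omega>))"
      by (auto simp: indicator_def)
  qed
  also have "\<dots> = (\<Sum>z\<in>UNIV. \<integral>\<^sup>+ \<omega>. g y * (indicator {\<omega> \<in> ?B. X (t + h) \<omega> = z} \<omega> * ?F \<omega>) \<partial>P x)"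
    using F s by (intro nn_integral_sum) auto
  also have "\<dots> = (\<Sum>z\<in>UNIV. g y * \<integral>\<^sup>+ \<omega>. indicator {\<omega> \<in> ?B. X (t + h) \<omega> = z} \<omega> * ?F \<omega> \<partial>P x)"
    using F s by (intro sum.cong nn_integral_cmult) auto
  also have "\<dots> = (\<Sum>z\<in>UNIV. g y * (emeasure (P x) {\<omega> \<in> ?B. X (t + h) \<omega> = z} * (ennreal_step h g ^^ n) f z))"
    using Suc.IH[OF th B'] by simp
  also have "\<dots> = (\<Sum>z\<in>UNIV. g y * (emeasure (P x) ?B * ennreal (transition h y z) * (ennreal_step h g ^^ n) f z))"
  proof (intro sum.cong refl)
    fix z
    have "measure (P x) {\<omega> \<in> ?B. X (t + h) \<omega> = z} = measure (P x) ?B * transition h y z"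
      using markov_property[OF Suc.prems(1) h Suc.prems(2)] by (simp add: transition_def)
    then have "emeasure (P x) {\<omega> \<in> ?B. X (t + h) \<omega> = z} = emeasure (P x) ?B * ennreal (transition h y z)"
      by (simp add: emeasure_eq_measure ennreal_mult transition_def)
    then show "g y * (emeasure (P x) {\<omega> \<in> ?B. X (t + h) \<omega> = z} * (ennreal_step h g ^^ n) f z) =
      g y * (emeasure (P x) ?B * ennreal (transition h y z) * (ennreal_step h g ^^ n) f z)" by simp
  qed
  also have "\<dots> = emeasure (P x) ?B * (ennreal_step h g ^^ Suc n) f y"
    by (simp add: ennreal_step_def sum_distrib_left mult_ac)
  finally show ?case .
qed

lemma nn_integral_chain:
  assumes h: "0 \<le> h"
  shows "(\<integral>\<^sup>+ \<omega>. (\<Prod>j<n. g (X (real j * h) \<omega>)) * f (X (real n * h) \<omega>) \<partial>P x) = (ennreal_step h g ^^ n) f x"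
proof -
  interpret prob_space "P x" by (rule prob_space_P)
  have "space M \<in> past_events M X 0"
    unfolding past_events_def by (rule sigma_sets_top)
  note chain = nn_integral_chain_past[OF h order_refl this, where x = x and y = x and n = n and g = g and f = f]
  have "AE \<omega> in P x. \<omega> \<in> {\<omega> \<in> space M. X 0 \<omega> = x}"
    using initial_state[of x] by (subst prob_eq_1[symmetric]) auto
  then have "(\<integral>\<^sup>+ \<omega>. (\<Prod>j<n. g (X (real j * h) \<omega>)) * f (X (real n * h) \<omega>) \<partial>P x) =
    (\<integral>\<^sup>+ \<omega>. indicator {\<omega> \<in> space M. X 0 \<omega> = x} \<omega> *
      ((\<Prod>j<n. g (X (0 + real j * h) \<omega>)) * f (X (0 + real n * h) \<omega>)) \<partial>P x)"
    by (intro nn_integral_cong_AE, eventually_elim) simp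
  also have "\<dots> = (ennreal_step h g ^^ n) f x"
    unfolding chain using initial_state[of x] by (simp add: emeasure_eq_measure)
  finally show ?thesis .
qed

section \<open>The one-step operator of the killed chain\<close>

definition grid_step :: "nat \<Rightarrow> ('a \<Rightarrow> real) \<Rightarrow> 'a \<Rightarrow> real" where
  "grid_step m f x = survival q m x * (\<Sum>z\<in>UNIV. transition (1 / real (Suc m)) x z * f z)"

lemma transition_nonneg: "0 \<le> transition h x z"
  by (simp add: transition_def)

lemma sum_transition: "0 \<le> h \<Longrightarrow> (\<Sum>z\<in>UNIV. transition h x z) = 1"
proof -
  assume h: "0 \<le> h"
  interpret prob_space "P x" by (rule prob_space_P)
  have "(\<Sum>z\<in>UNIV. transition h x z) = prob (\<Union>z\<in>UNIV. {\<omega> \<in> space M. X h \<omega> = z})"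
    unfolding transition_def
    by (rule finite_measure_finite_Union[symmetric]) (use h in \<open>auto simp: disjoint_family_on_def\<close>)
  also have "(\<Union>z\<in>UNIV. {\<omega> \<in> space M. X h \<omega> = z}) = space (P x)" by auto
  finally show ?thesis using prob_space by simp
qed

lemma grid_step_mono: "(\<And>x. f x \<le> g x) \<Longrightarrow> grid_step m f x \<le> grid_step m g x"
  unfolding grid_step_def
  by (intro mult_left_mono sum_mono transition_nonneg survival_bounds)

lemma grid_step_pow_mono: "(\<And>x. f x \<le> g x) \<Longrightarrow> (grid_step m ^^ n) f x \<le> (grid_step m ^^ n) g x"
  by (induction n arbitrary: x) (auto intro: grid_step_mono)

lemma grid_step_0: "grid_step m (\<lambda>_. 0) = (\<lambda>_. 0)"
  by (simp add: grid_step_def fun_eq_iff)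

lemma grid_step_pow_nonneg: "(\<And>x. 0 \<le> f x) \<Longrightarrow> 0 \<le> (grid_step m ^^ n) f x"
proof -
  assume "\<And>x. 0 \<le> f x"
  moreover have "(grid_step m ^^ n) (\<lambda>_. 0) = (\<lambda>_. 0)" by (induction n) (simp_all add: grid_step_0)
  ultimately show ?thesis using grid_step_pow_mono[where f = "\<lambda>_. 0" and g = f and m = m and n = n and x = x] by simp
qed

lemma grid_step_pow_diff:
  "(grid_step m ^^ n) (\<lambda>z. f z - g z) x = (grid_step m ^^ n) f x - (grid_step m ^^ n) g x"
  by (induction n arbitrary: x) (simp_all add: grid_step_def sum_subtractf right_diff_distrib)

lemma grid_step_pow_cmult: "(grid_step m ^^ n) (\<lambda>z. c * f z) x = c * (grid_step m ^^ n) f x"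
  by (induction n arbitrary: x) (simp_all add: grid_step_def sum_distrib_left mult_ac)

lemma grid_step_one_le: "grid_step m (\<lambda>_. 1) x \<le> 1"
  by (simp add: grid_step_def sum_transition survival_bounds)

lemma grid_step_pow_one_antimono:
  assumes "k \<le> n"
  shows "(grid_step m ^^ n) (\<lambda>_. 1) x \<le> (grid_step m ^^ k) (\<lambda>_. 1) x"
  using assms
proof (induction rule: dec_induct)
  case (step n)
  have "(grid_step m ^^ Suc n) (\<lambda>_. 1) x \<le> (grid_step m ^^ n) (\<lambda>_. 1) x"
    unfolding funpow_Suc_right o_def by (rule grid_step_pow_mono[OF grid_step_one_le])
  then show ?case using step by linarith
qed simp

lemma ennreal_step_eq:
  assumes "\<And>x. 0 \<le> f x"
  shows "ennreal_step (1 / real (Suc m)) (\<lambda>x. ennreal (survival q m x)) (\<lambda>x. ennreal (f x)) x =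
    ennreal (grid_step m f x)"
proof -
  have "(\<Sum>z\<in>UNIV. ennreal (transition (1 / real (Suc m)) x z) * ennreal (f z)) =
    ennreal (\<Sum>z\<in>UNIV. transition (1 / real (Suc m)) x z * f z)"
    using assms transition_nonneg by (subst sum_ennreal[symmetric]) (auto simp: ennreal_mult)
  moreover have "0 \<le> (\<Sum>z\<in>UNIV. transition (1 / real (Suc m)) x z * f z)"
    by (intro sum_nonneg mult_nonneg_nonneg transition_nonneg assms)
  ultimately show ?thesis
    by (simp only: ennreal_step_def grid_step_def ennreal_mult survival_bounds)
qed

lemma ennreal_step_pow:
  assumes "\<And>x. 0 \<le> f x"
  shows "(ennreal_step (1 / real (Suc m)) (\<lambda>x. ennreal (survival q m x)) ^^ n) (\<lambda>x. ennreal (f x)) =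
    (\<lambda>x. ennreal ((grid_step m ^^ n) f x))"
  using assms
proof (induction n)
  case (Suc n)
  then show ?case
    using ennreal_step_eq[of "(grid_step m ^^ n) f" m, OF grid_step_pow_nonneg[of f n m]] assms
    by (simp only: funpow.simps o_apply)
qed simp

section \<open>The grid kernel and its limit\<close>

abbreviation E :: "'a \<Rightarrow> ('w \<times> real) measure" where "E x \<equiv> P x \<Otimes>\<^sub>M exponential_clock"

lemma pair_prob_space_E: "pair_prob_space (P x) exponential_clock"
  by (simp add: pair_prob_space_def pair_sigma_finite_def prob_space_P prob_space_exponential_clock
      prob_space_imp_sigma_finite)

lemma space_E [simp]: "space (E x) = space M \<times> UNIV"
  by (simp add: space_pair_measure)

abbreviation grid_rate_at :: "nat \<Rightarrow> nat \<Rightarrow> 'w \<Rightarrow> ennreal" where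
  "grid_rate_at m n \<omega> \<equiv> grid_rate q (\<lambda>t. X t \<omega>) m n"

lemma measurable_grid_rate [measurable]: "grid_rate_at m n \<in> borel_measurable M"
  unfolding grid_rate_def
  by (intro borel_measurable_sum borel_measurable_times_ennreal borel_measurable_const measurable_fun_X) auto

lemma measurable_snd_E [measurable]: "(\<lambda>z. snd z) \<in> borel_measurable (E x)"
  by (rule measurable_compose[OF measurable_snd]) simp

lemma measurable_fst_E [measurable (raw)]:
  "f \<in> measurable M N' \<Longrightarrow> (\<lambda>z. f (fst z)) \<in> measurable (E x) N'"
  by (rule measurable_compose[OF measurable_fst]) (simp cong: measurable_cong_sets)

lemma measurable_X_grid [measurable]: "X (real n / real (Suc m)) \<in> measurable M (count_space UNIV)"
  by (rule measurable_X) simp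

text \<open>With \<open>n' = n\<close> the clock has survived all observations before the
  \<open>n\<close>-th, with \<open>n' = Suc n\<close> also that one. The difference is the
  probability of being killed at the \<open>n\<close>-th.\<close>

lemma measure_grid_survival:
  assumes "n' = n \<or> n' = Suc n"
  shows "measure (E x) {z \<in> space (E x). grid_rate_at m n' (fst z) < ennreal (snd z) \<and>
      X (real n / real (Suc m)) (fst z) \<in> Y} =
    (grid_step m ^^ n) (\<lambda>z. (if n' = n then 1 else survival q m z) * indicator Y z) x"
proof -
  interpret pair_prob_space "P x" exponential_clock by (rule pair_prob_space_E)
  let ?S = "{z \<in> space (E x). grid_rate_at m n' (fst z) < ennreal (snd z) \<and>
      X (real n / real (Suc m)) (fst z) \<in> Y}"
  let ?h = "1 / real (Suc m)"
  have S: "?S \<in> sets (E x)" by measurable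
  have "emeasure (E x) ?S = (\<integral>\<^sup>+ \<omega>. emeasure exponential_clock (Pair \<omega> -` ?S) \<partial>P x)"
    by (rule M2.emeasure_pair_measure_alt[OF S])
  also have "\<dots> = (\<integral>\<^sup>+ \<omega>. (\<Prod>j<n. ennreal (survival q m (X (real j * ?h) \<omega>))) *
      ennreal ((if n' = n then 1 else survival q m (X (real n * ?h) \<omega>)) * indicator Y (X (real n * ?h) \<omega>)) \<partial>P x)"
  proof (rule nn_integral_cong)
    fix \<omega> assume "\<omega> \<in> space (P x)"
    then have "Pair \<omega> -` ?S = (if X (real n / real (Suc m)) \<omega> \<in> Y then {u. grid_rate_at m n' \<omega> < ennreal u} else {})"
      by auto
    then show "emeasure exponential_clock (Pair \<omega> -` ?S) = (\<Prod>j<n. ennreal (survival q m (X (real j * ?h) \<omega>))) *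
      ennreal ((if n' = n then 1 else survival q m (X (real n * ?h) \<omega>)) * indicator Y (X (real n * ?h) \<omega>))"
      using assms by (auto simp: emeasure_grid_survival)
  qed
  also have "\<dots> = ennreal ((grid_step m ^^ n) (\<lambda>z. (if n' = n then 1 else survival q m z) * indicator Y z) x)"
    using nn_integral_chain[where h = ?h and n = n and x = x and g = "\<lambda>x. ennreal (survival q m x)"
        and f = "\<lambda>z. ennreal ((if n' = n then 1 else survival q m z) * indicator Y z)"]
    using ennreal_step_pow[of "\<lambda>z. (if n' = n then 1 else survival q m z) * indicator Y z" n m]
    by (simp add: survival_bounds)
  finally show ?thesis
    unfolding measure_def by (simp add: grid_step_pow_nonneg survival_bounds)
qed

abbreviation grid_killed :: "nat \<Rightarrow> nat \<Rightarrow> 'a \<Rightarrow> 'w \<times> real \<Rightarrow> bool" where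
  "grid_killed m n y z \<equiv> grid_killed_at q (\<lambda>t. X t (fst z)) (snd z) m n y"

lemma pred_grid_killed [measurable]: "Measurable.pred (E x) (grid_killed m n y)"
  unfolding grid_killed_at_def by measurable

definition grid_kernel :: "nat \<Rightarrow> 'a \<Rightarrow> 'a \<Rightarrow> real" where
  "grid_kernel m x y = measure (E x) {z \<in> space (E x). \<exists>n. grid_killed m n y z}"

text \<open>A Neumann series for \<open>I - grid_step m\<close>: its \<open>n\<close>-th term is the
  probability of being killed in \<open>y\<close> at observation \<open>n\<close>, and these events
  are disjoint since the grid rate is monotone.\<close>

lemma grid_kernel_sums:
  "(\<lambda>n. (grid_step m ^^ n) (\<lambda>z. (1 - survival q m z) * indicator {y} z) x) sums grid_kernel m x y"
proof -
  interpret pair_prob_space "P x" exponential_clock by (rule pair_prob_space_E)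
  let ?S = "\<lambda>n n'. {z \<in> space (E x). grid_rate_at m n' (fst z) < ennreal (snd z) \<and>
      X (real n / real (Suc m)) (fst z) \<in> {y}}"
  have S: "?S n n' \<in> sets (E x)" for n n' by measurable
  have eq: "measure (E x) {z \<in> space (E x). grid_killed m n y z} =
    (grid_step m ^^ n) (\<lambda>z. (1 - survival q m z) * indicator {y} z) x" for n
  proof -
    have sub: "?S n (Suc n) \<subseteq> ?S n n"
      using grid_rate_mono[of n "Suc n"] by (auto intro: le_less_trans)
    have "{z \<in> space (E x). grid_killed m n y z} = ?S n n - ?S n (Suc n)"
      by (auto simp: grid_killed_at_def not_less)
    then have "measure (E x) {z \<in> space (E x). grid_killed m n y z} =
      measure (E x) (?S n n) - measure (E x) (?S n (Suc n))"
      using P.finite_measure_Diff[OF S S sub] by simp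
    also have "\<dots> = (grid_step m ^^ n) (indicator {y}) x -
      (grid_step m ^^ n) (\<lambda>z. survival q m z * indicator {y} z) x"
      using measure_grid_survival[where n = n and n' = n and x = x and m = m and Y = "{y}"]
        measure_grid_survival[where n = n and n' = "Suc n" and x = x and m = m and Y = "{y}"] by simp
    also have "\<dots> = (grid_step m ^^ n) (\<lambda>z. indicator {y} z - survival q m z * indicator {y} z) x"
      by (simp add: grid_step_pow_diff)
    finally show ?thesis by (simp add: left_diff_distrib)
  qed
  have disj: "disjoint_family (\<lambda>n. {z \<in> space (E x). grid_killed m n y z})"
  proof -
    have "n = n'" if "grid_killed m n y z" "grid_killed m n' y z" for n n' z
    proof (rule ccontr)
      assume "n \<noteq> n'"
      then consider "Suc n \<le> n'" | "Suc n' \<le> n" by linarith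
      then show False
        using that grid_rate_mono[of "Suc n" n' q "\<lambda>t. X t (fst z)" m]
          grid_rate_mono[of "Suc n'" n q "\<lambda>t. X t (fst z)" m]
        unfolding grid_killed_at_def by cases (simp_all add: not_le, (meson leD order.trans)+)
    qed
    then show ?thesis by (auto simp: disjoint_family_on_def)
  qed
  have "range (\<lambda>n. {z \<in> space (E x). grid_killed m n y z}) \<subseteq> sets (E x)"
    by (rule image_subsetI) measurable
  moreover have "{z \<in> space (E x). \<exists>n. grid_killed m n y z} = (\<Union>n. {z \<in> space (E x). grid_killed m n y z})" by auto
  ultimately show ?thesis
    using P.finite_measure_UNION[OF _ disj] unfolding grid_kernel_def eq[symmetric] by metis
qed

text \<open>Applying \<open>grid_step m\<close> to the series shifts it by one term.\<close>

lemma grid_kernel_eq: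
  "grid_kernel m x y = (1 - survival q m x) * indicator {y} x + grid_step m (\<lambda>z. grid_kernel m z y) x"
proof -
  let ?a = "\<lambda>z. (1 - survival q m z) * indicator {y} z"
  have "(\<lambda>n. grid_step m ((grid_step m ^^ n) ?a) x) sums grid_step m (\<lambda>z. grid_kernel m z y) x"
    unfolding grid_step_def[of m _ x] by (intro sums_mult sums_sum grid_kernel_sums)
  then have "(\<lambda>n. (grid_step m ^^ Suc n) ?a x) sums grid_step m (\<lambda>z. grid_kernel m z y) x" by simp
  then have "(\<lambda>n. (grid_step m ^^ n) ?a x) sums (grid_step m (\<lambda>z. grid_kernel m z y) x + ?a x)"
    by (subst (asm) sums_Suc_iff) simp
  then show ?thesis using sums_unique2[OF grid_kernel_sums] by fastforce
qed

section \<open>Measurability of the killing position\<close>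

lemma cadlag_X: "\<omega> \<in> space M \<Longrightarrow> cadlag_path (\<lambda>t. X t \<omega>)"
  by unfold_locales (auto intro: right_continuous left_limits)

lemma measurable_pair_X: "(\<lambda>(s, \<omega>). X (max s 0) \<omega>) \<in> measurable (borel \<Otimes>\<^sub>M M) (count_space UNIV)"
  by (rule right_continuous_measurable_pair[OF measurable_X right_continuous])

lemma measurable_X_at:
  assumes [measurable]: "f \<in> borel_measurable (E x)"
  shows "(\<lambda>z. X (max (f z) 0) (fst z)) \<in> measurable (E x) (count_space UNIV)"
proof -
  have "(\<lambda>z. (f z, fst z)) \<in> measurable (E x) (borel \<Otimes>\<^sub>M M)" by measurable
  from measurable_compose[OF this measurable_pair_X] show ?thesis by simp
qed

abbreviation accumulated_at :: "real \<Rightarrow> 'w \<Rightarrow> ennreal" where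
  "accumulated_at t \<omega> \<equiv> accumulated_rate q (\<lambda>s. X s \<omega>) t"

lemma measurable_accumulated [measurable]: "accumulated_at t \<in> borel_measurable M"
proof -
  have "(\<lambda>z. (snd z, fst z)) \<in> measurable (M \<Otimes>\<^sub>M lborel) (borel \<Otimes>\<^sub>M M)" by measurable
  from measurable_compose[OF this measurable_pair_X]
  have "(\<lambda>z. X (max (snd z) 0) (fst z)) \<in> measurable (M \<Otimes>\<^sub>M lborel) (count_space UNIV)" by simp
  then have "(\<lambda>z. q (X (max (snd z) 0) (fst z))) \<in> borel_measurable (M \<Otimes>\<^sub>M lborel)"
    by (rule measurable_compose) simp
  moreover have "(\<lambda>z. indicator {0..t} (snd z) :: ennreal) \<in> borel_measurable (M \<Otimes>\<^sub>M lborel)"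
    by measurable
  ultimately have "(\<lambda>z. q (X (max (snd z) 0) (fst z)) * indicator {0..t} (snd z)) \<in> borel_measurable (M \<Otimes>\<^sub>M lborel)"
    by (rule borel_measurable_times_ennreal)
  then have "(\<lambda>\<omega>. \<integral>\<^sup>+ s. q (X (max s 0) \<omega>) * indicator {0..t} s \<partial>lborel) \<in> borel_measurable M"
    by (intro lborel.borel_measurable_nn_integral) (simp add: case_prod_beta')
  also have "(\<lambda>\<omega>. \<integral>\<^sup>+ s. q (X (max s 0) \<omega>) * indicator {0..t} s \<partial>lborel) = accumulated_at t"
    unfolding accumulated_rate_def
    by (intro ext nn_integral_cong) (auto simp: indicator_def max_def)
  finally show ?thesis .
qed

definition stopping_time :: "'w \<times> real \<Rightarrow> ereal" where
  "stopping_time z = killing_time (\<lambda>t _. X t (fst z)) q () (snd z)"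

text \<open>Rational times suffice, since a visit to an infinite rate lasts for a while by right
  continuity and the accumulated rate is monotone. Measurability then needs only a countable
  union.\<close>

lemma stopping_time_less_iff:
  assumes "fst z \<in> space M"
  shows "stopping_time z < c \<longleftrightarrow> (\<exists>r\<in>\<rat> \<inter> {0..}. ereal r < c \<and>
    (X r (fst z) \<in> infinite_killing q \<or> ennreal (snd z) \<le> accumulated_at r (fst z)))"
proof -
  interpret cadlag_path "\<lambda>t. X t (fst z)" q by (rule cadlag_X[OF assms])
  let ?Q = "\<lambda>t. X t (fst z) \<in> infinite_killing q \<or> ennreal (snd z) \<le> A t"
  have less: "stopping_time z < c \<longleftrightarrow> (\<exists>t\<ge>0. ereal t < c \<and> ?Q t)"
    unfolding stopping_time_def killing_time_def accumulated_rate_def Inf_less_iff by blast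
  have "\<exists>r\<in>\<rat> \<inter> {0..}. ereal r < c \<and> ?Q r" if t: "t \<ge> 0" "ereal t < c" "?Q t" for t
  proof -
    obtain d where d: "ereal t < ereal d" "ereal d < c" using ereal_dense2[OF t(2)] by blast
    obtain b where b: "b > t" "\<And>s. t \<le> s \<Longrightarrow> s < b \<Longrightarrow> X s (fst z) = X t (fst z)"
      by (rule right_const[OF t(1)]) blast
    obtain r where r: "r \<in> \<rat>" "t < r" "r < min b d"
      using Rats_dense_in_real[of t "min b d"] b(1) d(1) by auto
    have "X r (fst z) = X t (fst z)" by (rule b(2)) (use r in auto)
    moreover have "A t \<le> A r" using r by (intro A_mono) simp
    ultimately have "?Q r" using t(3) by auto
    moreover have "ereal r < c" using r d(2) by (metis ereal_less_eq(3) less_imp_le min_less_iff_conj order_le_less_trans)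
    ultimately show ?thesis using r t(1) by (intro bexI[of _ r]) auto
  qed
  then show ?thesis unfolding less by auto
qed

lemma measurable_stopping_time [measurable]: "stopping_time \<in> borel_measurable (E x)"
proof (rule borel_measurableI_less)
  fix c
  have [measurable]: "Measurable.pred (E x) (\<lambda>z. X r (fst z) \<in> infinite_killing q)" if "r \<in> \<rat> \<inter> {0..}" for r
    by (rule measurable_compose[OF measurable_fst_E[OF measurable_X]]) (use that in auto)
  let ?B = "\<lambda>r. {z \<in> space (E x). ereal r < c \<and>
    (X r (fst z) \<in> infinite_killing q \<or> ennreal (snd z) \<le> accumulated_at r (fst z))}"
  have "{z \<in> space (E x). stopping_time z < c} = (\<Union>r\<in>\<rat> \<inter> {0..}. ?B r)"
  proof (rule set_eqI)
    fix z
    show "z \<in> {z \<in> space (E x). stopping_time z < c} \<longleftrightarrow> z \<in> (\<Union>r\<in>\<rat> \<inter> {0..}. ?B r)"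
      using stopping_time_less_iff[of z c] by (cases "z \<in> space (E x)") (auto simp: mem_Times_iff)
  qed
  also have "\<dots> \<in> sets (E x)"
    by (rule sets.countable_UN') (auto simp: countable_rat intro: countable_subset[OF Int_lower1 countable_rat])
  finally show "{z \<in> space (E x). stopping_time z < c} \<in> sets (E x)" .
qed

abbreviation killed :: "'a \<Rightarrow> 'w \<times> real \<Rightarrow> bool" where
  "killed y z \<equiv> killed_at q (\<lambda>t. X t (fst z)) (snd z) y"

lemma stopping_time_nonneg: "0 \<le> stopping_time z"
  unfolding stopping_time_def killing_time_def by (rule Inf_greatest) auto

lemma pred_killed [measurable]: "Measurable.pred (E x) (killed y)"
proof -
  have [measurable]: "(\<lambda>z. X (max (real_of_ereal (stopping_time z)) 0) (fst z)) \<in> measurable (E x) (count_space UNIV)"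
    by (rule measurable_X_at) measurable
  have eq: "killed y z \<longleftrightarrow> stopping_time z < \<infinity> \<and> X (max (real_of_ereal (stopping_time z)) 0) (fst z) = y" for z
    unfolding killed_at_def stopping_time_def[symmetric]
    using real_of_ereal_pos[OF stopping_time_nonneg[of z]] by (simp add: max_absorb1)
  show ?thesis unfolding eq by measurable
qed

lemma killing_kernel_eq: "killing_kernel P X q x y = measure (E x) {z \<in> space (E x). killed y z}"
proof -
  have "killing_time X q \<omega> u = killing_time (\<lambda>t _. X t \<omega>) q () u" for \<omega> u
    by (simp add: killing_time_def)
  then show ?thesis
    unfolding killing_kernel_def killed_at_def by (simp add: case_prod_beta' mem_Times_iff)
qed

lemma AE_eventually_grid_killed:
  "AE z in E x. (\<exists>t::nat. ennreal (snd z) \<le> accumulated_at (real t) (fst z)) \<longrightarrow>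
     eventually (\<lambda>m. \<forall>y. (\<exists>n. grid_killed m n y z) \<longleftrightarrow> killed y z) sequentially"
proof -
  interpret pair_prob_space "P x" exponential_clock by (rule pair_prob_space_E)
  show ?thesis
  proof (rule AE_pair_measure)
    show "{z \<in> space (E x). (\<exists>t::nat. ennreal (snd z) \<le> accumulated_at (real t) (fst z)) \<longrightarrow>
      eventually (\<lambda>m. \<forall>y. (\<exists>n. grid_killed m n y z) \<longleftrightarrow> killed y z) sequentially} \<in> sets (E x)"
      unfolding eventually_sequentially by measurable
    show "AE \<omega> in P x. AE u in exponential_clock.
      (\<exists>t::nat. ennreal (snd (\<omega>, u)) \<le> accumulated_at (real t) (fst (\<omega>, u))) \<longrightarrow>
      eventually (\<lambda>m. \<forall>y. (\<exists>n. grid_killed m n y (\<omega>, u)) \<longleftrightarrow> killed y (\<omega>, u)) sequentially"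
    proof (rule AE_I2)
      fix \<omega> assume "\<omega> \<in> space (P x)"
      then interpret path: cadlag_path "\<lambda>t. X t \<omega>" q by (intro cadlag_X) simp
      \<comment> \<open>The values at integer times are excluded too, to sharpen
        \<open>\<le>\<close> into the strict inequality that \<open>countable_bad_levels\<close>
        asks for.\<close>
      define C where "C = {u. u > 0 \<and> (\<exists>t\<ge>0. ennreal u < path.A t) \<and> \<not> path.good_level u} \<union>
        range (\<lambda>t::nat. enn2real (path.A (real t)))"
      have "countable C" unfolding C_def using path.countable_bad_levels by simp
      then have "AE u in exponential_clock. 0 < u \<and> u \<notin> C" by (rule AE_exponential_clock)
      then show "AE u in exponential_clock.
        (\<exists>t::nat. ennreal (snd (\<omega>, u)) \<le> accumulated_at (real t) (fst (\<omega>, u))) \<longrightarrow>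
        eventually (\<lambda>m. \<forall>y. (\<exists>n. grid_killed m n y (\<omega>, u)) \<longleftrightarrow> killed y (\<omega>, u)) sequentially"
      proof eventually_elim
        case (elim u)
        show ?case
        proof
          assume "\<exists>t::nat. ennreal (snd (\<omega>, u)) \<le> accumulated_at (real t) (fst (\<omega>, u))"
          then obtain t :: nat where t: "ennreal u \<le> path.A (real t)" by auto
          have "ennreal u \<noteq> path.A (real t)"
          proof
            assume "ennreal u = path.A (real t)"
            then have "u = enn2real (path.A (real t))" using elim by (metis enn2real_ennreal less_imp_le)
            then have "u \<in> range (\<lambda>t::nat. enn2real (path.A (real t)))" by (rule range_eqI)
            then show False using elim unfolding C_def by blast
          qed
          then have "ennreal u < path.A (real t)" using t by simp
          then have "\<exists>t\<ge>0. ennreal u < path.A t" by (intro exI[of _ "real t"]) simp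
          then have "path.good_level u" using elim unfolding C_def by blast
          then show "eventually (\<lambda>m. \<forall>y. (\<exists>n. grid_killed m n y (\<omega>, u)) \<longleftrightarrow> killed y (\<omega>, u)) sequentially"
            using path.eventually_killed_at_iff[of u] elim by simp
        qed
      qed
    qed
  qed
qed

subsection \<open>Limits of the grid step\<close>

lemma filterlim_mesh: "filterlim (\<lambda>m. 1 / real (Suc m)) (at_right 0) sequentially"
proof (rule tendsto_imp_filterlim_at_right)
  show "(\<lambda>m. 1 / real (Suc m)) \<longlonglongrightarrow> 0"
    using LIMSEQ_inverse_real_of_nat by (simp add: inverse_eq_divide)
qed simp

lemma transition_deriv:
  "(\<lambda>m. (transition (1 / real (Suc m)) x z - indicator {z} x) * real (Suc m))
     \<longlonglongrightarrow> generator w (indicator {z}) x"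
proof -
  interpret prob_space "P x" by (rule prob_space_P)
  have "(\<lambda>m. ((\<integral>\<omega>. indicator {z} (X (1 / real (Suc m)) \<omega>) \<partial>P x) - indicator {z} x) / (1 / real (Suc m)))
    \<longlonglongrightarrow> generator w (indicator {z}) x"
    by (rule filterlim_compose[OF has_generator filterlim_mesh])
  moreover have "(\<integral>\<omega>. indicator {z} (X t \<omega>) \<partial>P x) = transition t x z" if "0 \<le> t" for t
  proof -
    have "(\<integral>\<omega>. indicator {z} (X t \<omega>) \<partial>P x) = (\<integral>\<omega>. indicator {\<omega> \<in> space M. X t \<omega> = z} \<omega> \<partial>P x :: real)"
      by (intro Bochner_Integration.integral_cong) (auto simp: indicator_def)
    then show ?thesis using that by (simp add: transition_def)
  qed
  ultimately show ?thesis by (simp del: of_nat_Suc)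
qed

lemma transition_tendsto: "(\<lambda>m. transition (1 / real (Suc m)) x z) \<longlonglongrightarrow> indicator {z} x"
proof -
  have "(\<lambda>m. (transition (1 / real (Suc m)) x z - indicator {z} x) * real (Suc m) * inverse (real (Suc m)))
    \<longlonglongrightarrow> generator w (indicator {z}) x * 0"
    by (intro tendsto_mult transition_deriv LIMSEQ_inverse_real_of_nat)
  then have "(\<lambda>m. transition (1 / real (Suc m)) x z - indicator {z} x) \<longlonglongrightarrow> 0"
    by (simp add: mult.assoc del: of_nat_Suc)
  then show ?thesis by (simp add: LIM_zero_iff)
qed

lemma survival_deriv:
  assumes "q x \<noteq> \<infinity>"
  shows "(\<lambda>m. (1 - survival q m x) * real (Suc m)) \<longlonglongrightarrow> enn2real (q x)"
proof -
  let ?r = "enn2real (q x)"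
  have "((\<lambda>t. exp (- ?r * t)) has_real_derivative - ?r) (at 0)"
    by (auto intro!: derivative_eq_intros)
  then have "((\<lambda>t. (exp (- ?r * t) - 1) / t) \<longlongrightarrow> - ?r) (at 0)"
    by (simp add: has_field_derivative_iff)
  then have "((\<lambda>t. (exp (- ?r * t) - 1) / t) \<longlongrightarrow> - ?r) (at_right 0)"
    by (rule filterlim_mono[OF _ order_refl]) (simp add: at_within_le_at)
  then have "(\<lambda>m. - ((exp (- ?r * (1 / real (Suc m))) - 1) / (1 / real (Suc m)))) \<longlonglongrightarrow> - (- ?r)"
    by (intro tendsto_minus filterlim_compose[OF _ filterlim_mesh])
  then show ?thesis using assms by (simp add: survival_def algebra_simps del: of_nat_Suc)
qed

lemma generator_expand: "(\<Sum>z\<in>UNIV. generator w (indicator {z}) x * v z) = generator w v x"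
proof -
  have "(\<Sum>z\<in>UNIV. generator w (indicator {z}) x * v z) =
    (\<Sum>y\<in>UNIV. \<Sum>z\<in>UNIV. w x y * (indicator {z} y - indicator {z} x) * v z)"
    unfolding generator_def sum_distrib_right by (rule sum.swap)
  also have "\<dots> = (\<Sum>y\<in>UNIV. w x y * (\<Sum>z\<in>UNIV. (indicator {z} y - indicator {z} x) * v z))"
    by (simp add: sum_distrib_left mult.assoc)
  also have "\<dots> = generator w v x"
  proof -
    have "(\<Sum>z\<in>UNIV. (indicator {z} y - indicator {z} x) * v z) = v y - v x" for y
    proof -
      have "(\<Sum>z\<in>UNIV. (indicator {z} y - indicator {z} x) * v z) =
        (\<Sum>z\<in>UNIV. (if z = y then v z else 0) - (if z = x then v z else 0))"
        by (intro sum.cong) (auto simp: indicator_def)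
      then show ?thesis by (simp add: sum_subtractf)
    qed
    then show ?thesis by (simp add: generator_def)
  qed
  finally show ?thesis .
qed

text \<open>With mesh \<open>h\<close>, \<open>(I - e_h P_h) / h\<close> is
  \<open>(1 - e_h) / h\<close> times \<open>P_h\<close>, minus \<open>(P_h - I) / h\<close>, and
  each part converges. Letting \<open>f\<close> vary with \<open>m\<close> covers
  \<open>grid_kernel m\<close> as well as a fixed function.\<close>

lemma grid_step_deriv:
  assumes x: "q x \<noteq> \<infinity>" and f: "\<And>z. (\<lambda>m. f m z) \<longlonglongrightarrow> g z"
  shows "(\<lambda>m. (f m x - grid_step m (f m) x) * real (Suc m)) \<longlonglongrightarrow> enn2real (q x) * g x - generator w g x"
proof -
  let ?p = "\<lambda>m z. transition (1 / real (Suc m)) x z"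
  have "(\<lambda>m. (1 - survival q m x) * real (Suc m) * (\<Sum>z\<in>UNIV. ?p m z * f m z) -
      (\<Sum>z\<in>UNIV. (?p m z - indicator {z} x) * real (Suc m) * f m z)) \<longlonglongrightarrow>
    enn2real (q x) * (\<Sum>z\<in>UNIV. indicator {z} x * g z) - (\<Sum>z\<in>UNIV. generator w (indicator {z}) x * g z)"
    by (intro tendsto_diff tendsto_mult tendsto_sum survival_deriv[OF x] transition_tendsto transition_deriv f)
  moreover have ind: "(\<Sum>z\<in>UNIV. indicator {z} x * h z) = h x" for h :: "'a \<Rightarrow> real"
  proof -
    have "(\<Sum>z\<in>UNIV. indicator {z} x * h z) = (\<Sum>z\<in>UNIV. if z = x then h z else 0)"
      by (intro sum.cong) (auto simp: indicator_def)
    then show ?thesis by simp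
  qed
  moreover have "(1 - survival q m x) * real (Suc m) * (\<Sum>z\<in>UNIV. ?p m z * f m z) -
      (\<Sum>z\<in>UNIV. (?p m z - indicator {z} x) * real (Suc m) * f m z) =
    (f m x - grid_step m (f m) x) * real (Suc m)" for m
  proof -
    have "(\<Sum>z\<in>UNIV. (?p m z - indicator {z} x) * real (Suc m) * f m z) =
      real (Suc m) * ((\<Sum>z\<in>UNIV. ?p m z * f m z) - (\<Sum>z\<in>UNIV. indicator {z} x * f m z))"
      unfolding sum_subtractf[symmetric] sum_distrib_left
      by (intro sum.cong refl) (simp only: algebra_simps)
    then show ?thesis
      unfolding grid_step_def by (simp only: ind) (simp only: algebra_simps)
  qed
  ultimately show ?thesis by (simp only: generator_expand)
qed

lemma grid_step_infinite: "q x = \<infinity> \<Longrightarrow> grid_step m f x = 0"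
  by (simp add: grid_step_def survival_def)


section \<open>The limiting kernel\<close>

text \<open>A solution \<open>v\<close> of the Poisson equation bounds the expected killing time on every fine grid.\<close>

lemma eventually_grid_survival_le:
  fixes v :: "'a \<Rightarrow> real"
  assumes inf: "\<And>x. q x = \<infinity> \<Longrightarrow> v x = 1"
    and fin: "\<And>x. q x \<noteq> \<infinity> \<Longrightarrow> enn2real (q x) * v x - generator w v x = 1"
  shows "\<exists>V. eventually (\<lambda>m. \<forall>n x. real n * (grid_step m ^^ n) (\<lambda>_. 1) x \<le> V * real (Suc m)) sequentially"
proof -
  define V where "V = Max (range (\<lambda>x. \<bar>v x\<bar>))"
  have V: "\<bar>v x\<bar> \<le> V" for x unfolding V_def by (rule Max_ge) auto
  have V0: "0 \<le> V" using V[of undefined] by linarith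
  \<comment> \<open>Any positive constant below the limit \<open>1\<close> would do. At a point of
    infinite rate the grid step vanishes and \<open>v x = 1\<close>, so the expression equals
    \<open>real (Suc m)\<close>.\<close>
  have drift: "eventually (\<lambda>m. 1 / 2 \<le> (v x - grid_step m v x) * real (Suc m)) sequentially" for x
  proof (cases "q x = \<infinity>")
    case True
    then show ?thesis by (simp add: grid_step_infinite inf)
  next
    case False
    have "(\<lambda>m. (v x - grid_step m v x) * real (Suc m)) \<longlonglongrightarrow> enn2real (q x) * v x - generator w v x"
      by (rule grid_step_deriv[OF False]) simp
    then have "(\<lambda>m. (v x - grid_step m v x) * real (Suc m)) \<longlonglongrightarrow> 1" by (simp only: fin[OF False])
    then have "eventually (\<lambda>m. 1 / 2 < (v x - grid_step m v x) * real (Suc m)) sequentially"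
      by (rule order_tendstoD) simp
    then show ?thesis by eventually_elim simp
  qed
  then have "eventually (\<lambda>m. \<forall>x. 1 / 2 \<le> (v x - grid_step m v x) * real (Suc m)) sequentially"
    by (simp add: eventually_all_finite)
  then have "eventually (\<lambda>m. \<forall>n x. real n * (grid_step m ^^ n) (\<lambda>_. 1) x \<le> 4 * V * real (Suc m)) sequentially"
  proof eventually_elim
    case (elim m)
    define c where "c = 1 / (2 * real (Suc m))"
    have c: "c > 0" by (simp add: c_def)
    have drift: "c * 1 \<le> v x - grid_step m v x" for x
      using elim[rule_format, of x] by (simp add: c_def field_simps del: of_nat_Suc)
    show ?case
    proof (intro allI)
      fix n x
      let ?T = "\<lambda>n f. (grid_step m ^^ n) f x"
      \<comment> \<open>The right-hand side telescopes in \<open>k\<close>. Survival decreases in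
        \<open>k\<close>, so \<open>n\<close> copies of its last value stay below the sum, which is
        at most \<open>2 * V\<close>; dividing by \<open>c\<close> gives
        \<open>4 * V * real (Suc m)\<close>.\<close>
      have step: "c * ?T k (\<lambda>_. 1) \<le> ?T k v - ?T (Suc k) v" for k
        using grid_step_pow_mono[where f = "\<lambda>_. c * 1" and g = "\<lambda>x. v x - grid_step m v x" and n = k and x = x, OF drift]
        unfolding grid_step_pow_cmult grid_step_pow_diff funpow_Suc_right o_def .
      have "real n * (c * ?T n (\<lambda>_. 1)) = (\<Sum>k<n. c * ?T n (\<lambda>_. 1))" by simp
      also have "\<dots> \<le> (\<Sum>k<n. ?T k v - ?T (Suc k) v)"
      proof (rule sum_mono)
        fix k assume "k \<in> {..<n}"
        then have "c * ?T n (\<lambda>_. 1) \<le> c * ?T k (\<lambda>_. 1)"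
          using c by (intro mult_left_mono grid_step_pow_one_antimono) auto
        then show "c * ?T n (\<lambda>_. 1) \<le> ?T k v - ?T (Suc k) v" using step[of k] by linarith
      qed
      also have "\<dots> = v x - ?T n v" using sum_lessThan_telescope'[of "\<lambda>k. ?T k v" n] by simp
      also have "\<dots> \<le> 2 * V"
      proof -
        have "(grid_step m ^^ n) (\<lambda>_. - V * 1) x \<le> ?T n v"
          by (rule grid_step_pow_mono) (use V in \<open>simp add: abs_le_iff minus_le_iff\<close>)
        then have "- V * ?T n (\<lambda>_. 1) \<le> ?T n v" unfolding grid_step_pow_cmult .
        moreover have "?T n (\<lambda>_. 1) \<le> 1" using grid_step_pow_one_antimono[of 0 n m x] by simp
        then have "V * ?T n (\<lambda>_. 1) \<le> V" using V0 by (intro mult_left_le)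
        ultimately show ?thesis using V[of x] by linarith
      qed
      finally show "real n * ?T n (\<lambda>_. 1) \<le> 4 * V * real (Suc m)"
        by (simp add: c_def field_simps del: of_nat_Suc)
    qed
  qed
  then show ?thesis by blast
qed

text \<open>If a path is never killed, its grid rate up to an integer time \<open>t\<close> stays
  below the clock on all sufficiently fine grids. The grid bound gives this probability at most
  \<open>V / real t\<close>, and \<open>t\<close> is arbitrary.\<close>

lemma AE_finite_lifetime:
  fixes v :: "'a \<Rightarrow> real"
  assumes inf: "\<And>x. q x = \<infinity> \<Longrightarrow> v x = 1"
    and fin: "\<And>x. q x \<noteq> \<infinity> \<Longrightarrow> enn2real (q x) * v x - generator w v x = 1"
  shows "AE z in E x. \<exists>t::nat. ennreal (snd z) \<le> accumulated_at (real t) (fst z)"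
proof -
  interpret pair_prob_space "P x" exponential_clock by (rule pair_prob_space_E)
  obtain V where V: "eventually (\<lambda>m. \<forall>n x. real n * (grid_step m ^^ n) (\<lambda>_. 1) x \<le> V * real (Suc m)) sequentially"
    using eventually_grid_survival_le[OF inf fin] by blast
  define G where "G = {z \<in> space (E x). \<forall>t::nat. accumulated_at (real t) (fst z) < ennreal (snd z)}"
  have G: "G \<in> sets (E x)" unfolding G_def by measurable
  have bound: "measure (E x) G \<le> V / real t" if t: "0 < t" for t :: nat
  proof -
    let ?S = "\<lambda>m. {z \<in> space (E x). grid_rate_at m (t * Suc m) (fst z) < ennreal (snd z)}"
    have S: "?S m \<in> sets (E x)" for m by measurable
    have mS: "measure (E x) (?S m) = (grid_step m ^^ (t * Suc m)) (\<lambda>_. 1) x" for m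
      using measure_grid_survival[where n = "t * Suc m" and n' = "t * Suc m" and m = m and x = x and Y = UNIV] by simp
    \<comment> \<open>How fine the grid must be depends on the path, so the event is covered by the
      increasing sets \<open>D N\<close>.\<close>
    define D where "D N = {z \<in> space (E x). \<forall>m\<ge>N. grid_rate_at m (t * Suc m) (fst z) < ennreal (snd z)}" for N
    have D: "D N \<in> sets (E x)" for N unfolding D_def by measurable
    have "incseq D" unfolding D_def by (auto simp: incseq_def)
    then have lim: "(\<lambda>N. measure (E x) (D N)) \<longlonglongrightarrow> measure (E x) (\<Union>N. D N)"
      using D by (intro P.finite_Lim_measure_incseq) auto
    obtain N0 where N0: "\<And>m. m \<ge> N0 \<Longrightarrow> \<forall>n x. real n * (grid_step m ^^ n) (\<lambda>_. 1) x \<le> V * real (Suc m)"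
      using V unfolding eventually_sequentially by blast
    have "measure (E x) (D N) \<le> V / real t" if N: "N \<ge> N0" for N
    proof -
      have "measure (E x) (D N) \<le> measure (E x) (?S N)"
        by (rule P.finite_measure_mono[OF _ S]) (auto simp: D_def)
      also have "\<dots> \<le> V / real t"
      proof -
        have "real (t * Suc N) * (grid_step N ^^ (t * Suc N)) (\<lambda>_. 1) x \<le> V * real (Suc N)"
          using N0[OF N] by blast
        then have "real (Suc N) * (real t * (grid_step N ^^ (t * Suc N)) (\<lambda>_. 1) x) \<le> real (Suc N) * V"
          by (simp only: of_nat_mult mult_ac)
        then have "real t * (grid_step N ^^ (t * Suc N)) (\<lambda>_. 1) x \<le> V"
          by (rule mult_left_le_imp_le) simp
        then show ?thesis unfolding mS using t by (simp only: pos_le_divide_eq of_nat_0_less_iff mult.commute)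
      qed
      finally show ?thesis .
    qed
    then have "measure (E x) (\<Union>N. D N) \<le> V / real t"
      by (intro LIMSEQ_le_const2[OF lim]) blast
    moreover have "G \<subseteq> (\<Union>N. D N)"
    proof
      fix z assume z: "z \<in> G"
      then interpret path: cadlag_path "\<lambda>s. X s (fst z)" q by (intro cadlag_X) (auto simp: G_def)
      have "path.A (real t) < ennreal (snd z)" using z by (simp add: G_def)
      then have "eventually (\<lambda>m. \<forall>n. real n / real (Suc m) < real t \<longrightarrow>
          grid_rate_at m (Suc n) (fst z) < ennreal (snd z)) sequentially"
        by (intro path.eventually_grid_rate_less) simp
      then have "eventually (\<lambda>m. grid_rate_at m (t * Suc m) (fst z) < ennreal (snd z)) sequentially"
      proof eventually_elim
        case (elim m)
        \<comment> \<open>The last of the \<open>t * Suc m\<close> observations has index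
          \<open>n\<close> and lies strictly before time \<open>t\<close>, as
          \<open>eventually_grid_rate_less\<close> requires.\<close>
        obtain n where n: "t * Suc m = Suc n" using t by (cases "t * Suc m") auto
        then have "real n < real (t * Suc m)" by simp
        then have "real n / real (Suc m) < real t" by (simp only: of_nat_mult pos_divide_less_eq of_nat_0_less_iff zero_less_Suc)
        then show ?case using elim n by simp
      qed
      then show "z \<in> (\<Union>N. D N)" using z unfolding eventually_sequentially D_def G_def by blast
    qed
    then have "measure (E x) G \<le> measure (E x) (\<Union>N. D N)" using D by (intro P.finite_measure_mono) auto
    ultimately show ?thesis by linarith
  qed
  have "measure (E x) G \<le> 0"
  proof (rule LIMSEQ_le_const)
    show "(\<lambda>t. V * inverse (real (Suc t))) \<longlonglongrightarrow> 0"
      using tendsto_mult[OF tendsto_const LIMSEQ_inverse_real_of_nat, of V] by simp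
    show "\<exists>N. \<forall>t\<ge>N. measure (E x) G \<le> V * inverse (real (Suc t))"
      using bound[of "Suc _"] by (auto simp: divide_inverse simp del: of_nat_Suc)
  qed
  then have "measure (E x) G = 0" by (simp add: measure_le_0_iff)
  then have "AE z in E x. z \<notin> G" using G by (simp add: P.prob_eq_0)
  then show ?thesis by (rule AE_mp) (rule AE_I2, auto simp: G_def not_less)
qed

lemma grid_kernel_tendsto:
  assumes "AE z in E x. \<exists>t::nat. ennreal (snd z) \<le> accumulated_at (real t) (fst z)"
  shows "(\<lambda>m. grid_kernel m x y) \<longlonglongrightarrow> killing_kernel P X q x y"
proof -
  interpret pair_prob_space "P x" exponential_clock by (rule pair_prob_space_E)
  let ?S = "\<lambda>m. {z \<in> space (E x). \<exists>n. grid_killed m n y z}" and ?K = "{z \<in> space (E x). killed y z}"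
  have [measurable]: "?S m \<in> sets (E x)" "?K \<in> sets (E x)" for m by measurable
  have "(\<lambda>m. \<integral>z. indicator (?S m) z \<partial>E x) \<longlonglongrightarrow> (\<integral>z. indicator ?K z \<partial>E x :: real)"
  proof (rule integral_dominated_convergence[where w = "\<lambda>_. 1"])
    show "AE z in E x. (\<lambda>m. indicator (?S m) z :: real) \<longlonglongrightarrow> indicator ?K z"
      using assms AE_eventually_grid_killed[of x]
    proof eventually_elim
      case (elim z)
      then have "eventually (\<lambda>m. \<forall>y. (\<exists>n. grid_killed m n y z) \<longleftrightarrow> killed y z) sequentially" by blast
      then have "eventually (\<lambda>m. indicator (?S m) z = (indicator ?K z :: real)) sequentially"
        by eventually_elim (simp add: indicator_def)
      then show ?case by (rule tendsto_eventually)
    qed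
  qed (auto simp: indicator_def)
  then show ?thesis by (simp add: grid_kernel_def killing_kernel_eq Int_absorb2 sets.sets_into_space)
qed

lemma killing_kernel_infinite:
  assumes "(\<lambda>m. grid_kernel m x y) \<longlonglongrightarrow> killing_kernel P X q x y" and "q x = \<infinity>"
  shows "killing_kernel P X q x y = indicator {y} x"
proof -
  have "grid_kernel m x y = indicator {y} x" for m
    using grid_kernel_eq[of m x y] assms(2) by (simp add: grid_step_infinite survival_def)
  then show ?thesis using LIMSEQ_unique[OF assms(1)] by simp
qed

lemma killing_kernel_finite:
  assumes lim: "\<And>z. (\<lambda>m. grid_kernel m z y) \<longlonglongrightarrow> killing_kernel P X q z y" and x: "q x \<noteq> \<infinity>"
  shows "enn2real (q x) * killing_kernel P X q x y - generator w (\<lambda>z. killing_kernel P X q z y) x =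
    enn2real (q x) * indicator {y} x"
proof (rule LIMSEQ_unique)
  show "(\<lambda>m. (grid_kernel m x y - grid_step m (\<lambda>z. grid_kernel m z y) x) * real (Suc m)) \<longlonglongrightarrow>
    enn2real (q x) * killing_kernel P X q x y - generator w (\<lambda>z. killing_kernel P X q z y) x"
    by (rule grid_step_deriv[OF x lim])
  have "grid_kernel m x y - grid_step m (\<lambda>z. grid_kernel m z y) x = (1 - survival q m x) * indicator {y} x" for m
    using grid_kernel_eq[of m x y] by linarith
  then have "(\<lambda>m. (grid_kernel m x y - grid_step m (\<lambda>z. grid_kernel m z y) x) * real (Suc m)) =
    (\<lambda>m. (1 - survival q m x) * real (Suc m) * indicator {y} x)"
    by (simp add: mult_ac del: of_nat_Suc)
  then show "(\<lambda>m. (grid_kernel m x y - grid_step m (\<lambda>z. grid_kernel m z y) x) * real (Suc m)) \<longlonglongrightarrow>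
    enn2real (q x) * indicator {y} x"
    by (simp only:) (intro tendsto_mult survival_deriv[OF x] tendsto_const)
qed

lemma generator_step_weight: "q x \<noteq> \<infinity> \<Longrightarrow> generator (step_weight w q) f x = generator w f x"
  unfolding generator_def by (rule sum.cong) (auto simp: step_weight_def)

lemma generator_step_weight_infinite: "q x = \<infinity> \<Longrightarrow> generator (step_weight w q) f x = 0"
  unfolding generator_def by (rule sum.neutral) (auto simp: step_weight_def)

lemma killing_kernel_linear_system:
  assumes w: "\<And>x y. w x y \<ge> 0" and irr: "irreducible_rates w" and q: "\<exists>x. q x > 0"
  shows "forest_matrix (step_weight w q) ** (\<chi> x y. killing_kernel P X q x y) =
    (\<chi> x y. if x = y then step_weight w q x x else 0)"
proof -
  let ?D = "forest_matrix (step_weight w q)" and ?K = "killing_kernel P X q"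
  have "invertible ?D" using det_forest_matrix_nonzero[OF w irr q] invertible_det_nz by blast
  then obtain D' where D': "?D ** D' = mat 1" unfolding invertible_def by blast
  \<comment> \<open>A Lyapunov function for the killed chain: it solves the Poisson equation at
    points of finite rate, and the unit rows of \<open>?D\<close> give it the value \<open>1\<close>
    elsewhere.\<close>
  define v where "v = D' *v 1"
  have "?D *v v = 1" unfolding v_def by (simp add: matrix_vector_mul_assoc D')
  then have "(\<Sum>z\<in>UNIV. ?D $ x $ z * v $ z) = 1" for x
    by (simp add: matrix_vector_mult_def vec_eq_iff)
  then have v: "step_weight w q x x * v $ x - generator (step_weight w q) (($) v) x = 1" for x
    unfolding forest_matrix_mult .
  have lim: "(\<lambda>m. grid_kernel m x y) \<longlonglongrightarrow> ?K x y" for x y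
  proof (rule grid_kernel_tendsto, rule AE_finite_lifetime)
    show "v $ x = 1" if "q x = \<infinity>" for x
      using v[of x] that by (simp add: generator_step_weight_infinite step_weight_def)
    show "enn2real (q x) * v $ x - generator w (($) v) x = 1" if "q x \<noteq> \<infinity>" for x
      using v[of x] that by (simp add: generator_step_weight step_weight_def)
  qed
  have "(?D ** (\<chi> x y. ?K x y)) $ x $ y = (if x = y then step_weight w q x x else 0)" for x y
  proof -
    have "(?D ** (\<chi> x y. ?K x y)) $ x $ y =
      step_weight w q x x * ?K x y - generator (step_weight w q) (\<lambda>z. ?K z y) x"
      using forest_matrix_mult[of "step_weight w q" x "\<lambda>z. ?K z y"] by (simp add: matrix_matrix_mult_def)
    also have "\<dots> = (if x = y then step_weight w q x x else 0)"
    proof (cases "q x = \<infinity>")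
      case True
      then show ?thesis
        using killing_kernel_infinite[OF lim True, of y]
        by (cases "x = y") (simp_all add: generator_step_weight_infinite step_weight_def)
    next
      case False
      then show ?thesis
        using killing_kernel_finite[OF lim False, of y]
        by (cases "x = y") (simp_all add: generator_step_weight step_weight_def)
    qed
    finally show ?thesis .
  qed
  then show ?thesis by (simp add: vec_eq_iff)
qed

end

theorem theorem2:
  fixes w :: "'a::finite \<Rightarrow> 'a \<Rightarrow> real"
    and q :: "'a \<Rightarrow> ennreal"
    and M :: "'w measure"
    and P :: "'a \<Rightarrow> 'w measure"
    and X :: "real \<Rightarrow> 'w \<Rightarrow> 'a"
    and N :: "'v measure"
    and \<Phi> :: "'v \<Rightarrow> ('a \<times> 'a) set"
  assumes "\<And>x y. w x y \<ge> 0"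
    and "irreducible_rates w"
    and "markov_process w M P X"
    and "\<exists>x. q x > 0"
    and "prob_space N"
    and "\<Phi> \<in> measurable N (count_space (forests w))"
    and "\<And>\<phi>. \<phi> \<in> forests w \<Longrightarrow> measure N {\<eta> \<in> space N. \<Phi> \<eta> = \<phi>} = forest_law w q \<phi>"
  shows "\<forall>A. measure N {\<eta> \<in> space N. A \<subseteq> roots (\<Phi> \<eta>)} = det_on A (killing_kernel P X q)"
proof
  fix A
  interpret killed_markov_process w M P X q using assms(3) by (simp add: killed_markov_process_def)
  show "measure N {\<eta> \<in> space N. A \<subseteq> roots (\<Phi> \<eta>)} = det_on A (killing_kernel P X q)"
    by (rule prob_subset_roots[OF assms(1,2,4-7) killing_kernel_linear_system[OF assms(1,2,4)]])
qed

end
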